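(* $$\sum_{r,s,n\ge0}spt(r,s,n)d^re^sq^n=Spt(d,e;q).$$
   Context: An overpartition is a partition where the first occurrence of each part size may be overlined; an overpartition pair $(\lambda,\mu)$ of $n$ is a pair of overpartitions with total sum of parts $n$. For integers $r,s,n\ge0$, $spt(r,s,n)$ is the total number of appearances of the smallest part, summed over all overpartition pairs $(\lambda,\mu)$ of $n$ such that $r$ equals the number of overlined parts of $\lambda$ plus the number of non-overlined parts of $\mu$, $s$ equals the number of parts of $\mu$, and the smallest part size of $(\lambda,\mu)$ occurs only non-overlined and only in $\lambda$ (other pairs contribute nothing). With $(a_1,\dots,a_j)_\infty=\prod_{t\ge0}\prod_i(1-a_iq^t)$ and $(a_1,\dots,a_j)_n=(a_1,\dots,a_j)_\infty/(a_1q^n,\dots,a_jq^n)_\infty$ for $n\in\mathbb{Z}$, define $$\mathcal{N}_2(d,e;q):=\frac{(-dq,-eq)_\infty}{(q,deq)_\infty}\sum_{n\ne0}\frac{(-1)^{n-1}q^{\binom{n+1}2+n}(de)^n(-1/d,-1/e)_n}{(1-q^n)^2(-dq,-eq)_n},\qquad Spt(d,e;q):=\frac{(-dq,-eq)_\infty}{(q,deq)_\infty}\sum_{n\ge1}\frac{nq^n}{1-q^n}-\mathcal{N}_2(d,e;q).$$ The identity is one of formal power series. *)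

theory Defs
  imports
    "HOL-Analysis.Analysis"
    "HOL-Computational_Algebra.Formal_Laurent_Series"
    "HOL-Computational_Algebra.Fraction_Field"
    "HOL-Library.Multiset"
begin

section \<open>Overpartition pairs and the counting function\<close>

text \<open>
  A partition is a finite multiset of positive integers.  Since only the first occurrence of a
  part size may be overlined, an overpartition is a partition together with the set of those
  part sizes whose first occurrence is overlined.
\<close>

type_synonym overpartition = "nat multiset \<times> nat set"

definition is_overpartition :: "overpartition \<Rightarrow> bool" where
  "is_overpartition \<pi> \<longleftrightarrow> 0 \<notin># fst \<pi> \<and> snd \<pi> \<subseteq> set_mset (fst \<pi>)"

definition num_parts :: "overpartition \<Rightarrow> nat" where
  "num_parts \<pi> = size (fst \<pi>)"

definition num_overlined :: "overpartition \<Rightarrow> nat" where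
  "num_overlined \<pi> = card (snd \<pi>)"

definition num_nonoverlined :: "overpartition \<Rightarrow> nat" where
  "num_nonoverlined \<pi> = num_parts \<pi> - num_overlined \<pi>"

definition overpartition_pairs :: "nat \<Rightarrow> (overpartition \<times> overpartition) set" where
  "overpartition_pairs n =
     {(l, m). is_overpartition l \<and> is_overpartition m \<and>
        sum_mset (fst l) + sum_mset (fst m) = n}"

text \<open>Only meaningful for a pair that is not empty.\<close>

definition smallest_part :: "overpartition \<times> overpartition \<Rightarrow> nat" where
  "smallest_part p = Min (set_mset (fst (fst p) + fst (snd p)))"

text \<open>
  The pairs that contribute: the pair has a smallest part, and this part size occurs
  only non-overlined and only in the first component.
\<close>

definition spt_admissible :: "overpartition \<times> overpartition \<Rightarrow> bool" where
  "spt_admissible p \<longleftrightarrow>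
     fst (fst p) + fst (snd p) \<noteq> {#} \<and>
     smallest_part p \<notin> snd (fst p) \<and>
     smallest_part p \<notin># fst (snd p)"

text \<open>
  In an admissible pair the smallest part appears in the first component only, so that its
  appearances are counted there.
\<close>

definition spt :: "nat \<Rightarrow> nat \<Rightarrow> nat \<Rightarrow> nat" where
  "spt r s n =
     (\<Sum>(l, m) \<in> {(l, m) \<in> overpartition_pairs n.
          r = num_overlined l + num_nonoverlined m \<and>
          s = num_parts m \<and> spt_admissible (l, m)}.
        count (fst l) (smallest_part (l, m)))"


section \<open>The $q$-series\<close>

text \<open>
  The base $q$ is the indeterminate \<^const>\<open>fls_X\<close> of formal Laurent series over a field.
  All infinite products and sums are limits in the $q$-adic topology that the library puts
  on \<^typ>\<open>'a fls\<close>.  A list holds the arguments $a_1,\dots,a_j$ of the multiple symbol.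
\<close>

definition qpoch_inf :: "'a::field fls list \<Rightarrow> 'a fls" where
  "qpoch_inf as = (\<Prod>t. \<Prod>a\<leftarrow>as. 1 - a * fls_X ^ t)"

definition qpoch :: "'a::field fls list \<Rightarrow> int \<Rightarrow> 'a fls" where
  "qpoch as n = qpoch_inf as / qpoch_inf (map (\<lambda>a. a * fls_X powi n) as)"

text \<open>
  In the bilateral sum the binomial coefficient $\binom{n+1}{2}$ has an arbitrary integer $n$ and
  is written out as $(n+1)n/2$ (the product is even, so that the integer division is exact).
\<close>

definition N2 :: "'a::field fls \<Rightarrow> 'a fls \<Rightarrow> 'a fls" where
  "N2 d e =
     qpoch_inf [- d * fls_X, - e * fls_X] / qpoch_inf [fls_X, d * e * fls_X] *
     (\<Sum>\<^sub>\<infinity>n\<in>{n::int. n \<noteq> 0}.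
        ((- 1) powi (n - 1) * fls_X powi ((n + 1) * n div 2 + n) * (d * e) powi n *
           qpoch [- (1 / d), - (1 / e)] n) /
        ((1 - fls_X powi n)\<^sup>2 * qpoch [- d * fls_X, - e * fls_X] n))"

definition Spt :: "'a::field fls \<Rightarrow> 'a fls \<Rightarrow> 'a fls" where
  "Spt d e =
     qpoch_inf [- d * fls_X, - e * fls_X] / qpoch_inf [fls_X, d * e * fls_X] *
       (\<Sum>\<^sub>\<infinity>n\<in>{n::nat. n \<ge> 1}. of_nat n * fls_X ^ n / (1 - fls_X ^ n))
     - N2 d e"

text \<open>
  The individual terms of \<^const>\<open>N2\<close> involve $1/d$, $1/e$ and (for negative $n$) $1/(1+d)$ and
  $1/(1+e)$.  The indeterminates $d$ and $e$ are therefore taken in the field of fractions of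
  $\mathbb{Z}[d][e]$, the coefficient field of the series in $q$.
\<close>

definition d_var :: "int poly poly fract fls" where
  "d_var = fls_const (Fract [:[:0, 1:]:] 1)"

definition e_var :: "int poly poly fract fls" where
  "e_var = fls_const (Fract [:0, 1:] 1)"

end

theory Submission
  imports Defs
begin

text \<open>
  Sorting the contributing pairs by their smallest part $k$, which occurs $j \ge 1$ times, gives
  \[ \sum_{k\ge1} \frac{q^k}{(1-q^k)^2}\,
     \frac{(-dq^{k+1},-eq^{k+1})_\infty}{(q^{k+1},deq^{k+1})_\infty}
   = \frac{(-dq,-eq)_\infty}{(q,deq)_\infty} \sum_{n\ge1} (q)_{n-1}^2\, q^n \beta_n,
   \qquad \beta_n = \frac{(deq)_n}{(q,-dq,-eq)_n}. \]
  Here $\beta_n = \sum_{r\le n} \alpha_r/((q)_{n-r}(q)_{n+r})$ belongs to a Bailey pair relative to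
  $a=1$, and after exchanging the summations the inner sum over $n$ telescopes to
  $q^r/(1-q^r)^2$.  The term with $\alpha_0=1$ is the Lambert series, and for $r \ge 1$ the term with
  $\alpha_r$ combines the summands $r$ and $-r$ of $\mathcal{N}_2$.  Both facts hold as identities of
  finite sums up to $N$, so that convergence only enters in the last step $N\to\infty$.
\<close>

text \<open>The weight (q)_(n-1)^2 q^n is what Bailey's lemma at a = 1 leaves when both of its
  parameters tend to 1. Since (rho)_n = (1 - rho)(rho q)_(n-1), dividing by (1 - rho_1)(1 - rho_2)
  keeps a finite value for n >= 1, while the summand n = 0 diverges and has to be dropped. In the
  same limit the weight of alpha_r becomes (q)_(r-1)^2 q^r / (q)_r^2 = q^r / (1 - q^r)^2, but only
  for r >= 1. This is why r = 0 falls outside the pattern and is treated apart. The Bailey pair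
  itself is the unit pair moved one step along the Bailey chain with parameters -1/d and -1/e, which
  explains the symbols in the bilateral sum.\<close>

unbundle fps_syntax
notation fls_nth (infixl \<open>$$\<close> 75)

section \<open>The $q$-adic topology on formal Laurent series\<close>

definition fls_vanish :: "int \<Rightarrow> 'a::zero fls \<Rightarrow> bool" where
  "fls_vanish m f \<longleftrightarrow> (\<forall>i<m. f $$ i = 0)"

text \<open>That is, $f \in q^m K[[q]]$: membership in these sets describes the neighbourhoods of $0$.\<close>

lemma fls_vanishI: "(\<And>i. i < m \<Longrightarrow> f $$ i = 0) \<Longrightarrow> fls_vanish m f"
  by (simp add: fls_vanish_def)

lemma fls_vanishD: "fls_vanish m f \<Longrightarrow> i < m \<Longrightarrow> f $$ i = 0"
  by (simp add: fls_vanish_def)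

lemma fls_vanish_iff: "fls_vanish m f \<longleftrightarrow> f = 0 \<or> m \<le> fls_subdegree f"
proof
  assume f: "fls_vanish m f"
  show "f = 0 \<or> m \<le> fls_subdegree f"
  proof (cases "f = 0")
    case False
    then have "f $$ fls_subdegree f \<noteq> 0" by simp
    then show ?thesis using f by (metis fls_vanishD linorder_not_le)
  qed simp
qed (auto simp: fls_vanish_def)

lemma fls_vanish_0 [simp]: "fls_vanish m 0"
  by (simp add: fls_vanish_def)

lemma fls_vanish_mono: "fls_vanish m f \<Longrightarrow> k \<le> m \<Longrightarrow> fls_vanish k f"
  by (auto simp: fls_vanish_def)

lemma fls_vanish_add: "fls_vanish m f \<Longrightarrow> fls_vanish m g \<Longrightarrow> fls_vanish m (f + g)"
  for f :: "'a::monoid_add fls"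
  by (simp add: fls_vanish_def)

lemma fls_vanish_diff: "fls_vanish m f \<Longrightarrow> fls_vanish m g \<Longrightarrow> fls_vanish m (f - g)"
  for f :: "'a::group_add fls"
  by (simp add: fls_vanish_def)

lemma fls_vanish_minus_iff: "fls_vanish m (- f) \<longleftrightarrow> fls_vanish m f"
  for f :: "'a::group_add fls"
  by (simp add: fls_vanish_def)

lemma fls_vanish_diff_commute: "fls_vanish m (f - g) \<longleftrightarrow> fls_vanish m (g - f)"
  for f :: "'a::group_add fls"
  using fls_vanish_minus_iff[of m "f - g"] by simp

lemma fls_vanish_diff_trans:
  "fls_vanish m (f - g) \<Longrightarrow> fls_vanish m (g - h) \<Longrightarrow> fls_vanish m (f - h)"
  for f :: "'a::group_add fls"
  using fls_vanish_add[of m "f - g" "g - h"] by (simp add: add_diff_eq)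

lemma fls_vanish_sum: "(\<And>x. x \<in> A \<Longrightarrow> fls_vanish m (f x)) \<Longrightarrow> fls_vanish m (sum f A)"
  for f :: "'b \<Rightarrow> 'a::comm_monoid_add fls"
  by (induction A rule: infinite_finite_induct) (auto intro: fls_vanish_add)

lemma fls_vanish_mult: "fls_vanish m f \<Longrightarrow> fls_vanish k g \<Longrightarrow> fls_vanish (m + k) (f * g)"
  for f :: "'a::{comm_monoid_add, mult_zero} fls"
proof (cases "f = 0 \<or> g = 0")
  case False
  then show "fls_vanish m f \<Longrightarrow> fls_vanish k g \<Longrightarrow> ?thesis"
    unfolding fls_vanish_iff[of m f] fls_vanish_iff[of k g] by (auto intro!: fls_vanishI fls_times_nth_eq0)
qed auto

lemma fls_vanish_mult_left: "fls_vanish m f \<Longrightarrow> fls_vanish 0 g \<Longrightarrow> fls_vanish m (g * f)"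
  and fls_vanish_mult_right: "fls_vanish m f \<Longrightarrow> fls_vanish 0 g \<Longrightarrow> fls_vanish m (f * g)"
  for f :: "'a::{comm_monoid_add, mult_zero} fls"
  using fls_vanish_mult[of m f 0 g] fls_vanish_mult[of 0 g m f] by simp_all

lemma fls_vanish_1 [simp]: "fls_vanish 0 1"
  by (simp add: fls_vanish_def)

lemma fls_vanish_const [simp]: "fls_vanish 0 (fls_const c)"
  by (simp add: fls_vanish_def)

lemma fls_vanish_X_power: "fls_vanish m (fls_X ^ n :: 'a::semiring_1 fls) \<longleftrightarrow> m \<le> int n"
  by (auto simp: fls_vanish_def fls_X_power_nth)

lemma fls_vanish_of_nat [simp]: "fls_vanish 0 (of_nat n :: 'a::semiring_1 fls)"
  by (simp add: fls_vanish_def fls_of_nat_nth)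

lemma fls_vanish_prod: "(\<And>x. x \<in> A \<Longrightarrow> fls_vanish 0 (f x)) \<Longrightarrow> fls_vanish 0 (prod f A)"
  for f :: "'b \<Rightarrow> 'a::comm_semiring_1 fls"
  by (induction A rule: infinite_finite_induct) (auto intro: fls_vanish_mult_left)

text \<open>A multiplier with a pole would spoil a congruence modulo q^m. In the splitting f (h - k)
  + (f - g) k the multipliers are f and k, so these are the two required to be power series.\<close>

lemma fls_vanish_mult_cong:
  fixes f g h k :: "'a::comm_ring_1 fls"
  assumes "fls_vanish m (f - g)" "fls_vanish m (h - k)" "fls_vanish 0 f" "fls_vanish 0 k"
  shows "fls_vanish m (f * h - g * k)"
proof -
  have "f * h - g * k = f * (h - k) + (f - g) * k" by (simp add: algebra_simps)
  then show ?thesis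
    using fls_vanish_add[OF fls_vanish_mult_left[OF assms(2,3)] fls_vanish_mult_right[OF assms(1,4)]] by simp
qed

lemma fls_vanish_prod_minus_1:
  fixes f :: "'b \<Rightarrow> 'a::comm_ring_1 fls"
  assumes "\<And>x. x \<in> A \<Longrightarrow> fls_vanish m (f x - 1)" "m \<ge> 0"
  shows "fls_vanish m (prod f A - 1)"
  using assms(1)
proof (induction A rule: infinite_finite_induct)
  case (insert x A)
  have "fls_vanish 0 (f x)"
    using fls_vanish_add[OF fls_vanish_mono[OF insert.prems assms(2)] fls_vanish_1, of x] by simp
  then show ?case using insert fls_vanish_mult_cong[of m "f x" 1 "prod f A" 1] by simp
qed simp_all

text \<open>The distance is 2^(-v) with v the subdegree of f - g, and strictness turns into v >= n +
  1. If v is negative, the distance exceeds 1 and both sides fail.\<close>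

lemma dist_fls_less_iff:
  "dist f g < inverse (2 ^ n) \<longleftrightarrow> fls_vanish (int n + 1) (f - g)" for f g :: "'a::group_add fls"
proof (cases "f = g")
  case False
  then have fg: "f - g \<noteq> 0" by simp
  show ?thesis
  proof (cases "fls_subdegree (f - g) \<ge> 0")
    case True
    then show ?thesis using False fg by (auto simp: dist_fls_def fls_vanish_iff)
  next
    case neg: False
    have "\<not> (2 ^ nat (- fls_subdegree (f - g)) < inverse (2 ^ n :: real))"
    proof -
      have "inverse (2 ^ n :: real) \<le> 1" by (simp add: inverse_le_1_iff)
      moreover have "(1::real) \<le> 2 ^ nat (- fls_subdegree (f - g))" by simp
      ultimately show ?thesis by linarith
    qed
    then show ?thesis using False fg neg by (auto simp: dist_fls_def fls_vanish_iff)
  qed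
qed simp

lemma tendsto_fls_iff:
  fixes g :: "'a::group_add fls"
  shows "(f \<longlongrightarrow> g) F \<longleftrightarrow> (\<forall>m. eventually (\<lambda>x. fls_vanish m (f x - g)) F)"
proof
  assume lim: "(f \<longlongrightarrow> g) F"
  show "\<forall>m. eventually (\<lambda>x. fls_vanish m (f x - g)) F"
  proof
    fix m
    have "eventually (\<lambda>x. dist (f x) g < inverse (2 ^ nat m)) F"
      using lim by (intro tendstoD) auto
    then show "eventually (\<lambda>x. fls_vanish m (f x - g)) F"
      unfolding dist_fls_less_iff by eventually_elim (erule fls_vanish_mono, simp)
  qed
next
  assume *: "\<forall>m. eventually (\<lambda>x. fls_vanish m (f x - g)) F"
  show "(f \<longlongrightarrow> g) F"
  proof (rule tendstoI)
    fix \<epsilon> :: real assume "\<epsilon> > 0"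
    then obtain n where n: "inverse (2 ^ n) < \<epsilon>"
      using real_arch_pow_inv[of \<epsilon> "1/2"] by (auto simp: power_one_over inverse_eq_divide)
    have "eventually (\<lambda>x. fls_vanish (int n + 1) (f x - g)) F" using * by blast
    then show "eventually (\<lambda>x. dist (f x) g < \<epsilon>) F"
      unfolding dist_fls_less_iff[symmetric] by eventually_elim (use n in simp)
  qed
qed

lemma eventually_fls_vanish_nhds: "eventually (\<lambda>g. fls_vanish m (g - f)) (nhds f)"
  for f :: "'a::group_add fls"
  using filterlim_ident[of "nhds f"] unfolding tendsto_fls_iff by simp

lemma tendsto_fls_offsetI:
  fixes g :: "'a::group_add fls"
  assumes "\<And>n. fls_vanish (int n) (f n - g)"
  shows "f \<longlonglongrightarrow> g"
  unfolding tendsto_fls_iff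
proof
  fix m
  show "eventually (\<lambda>n. fls_vanish m (f n - g)) sequentially"
    using eventually_ge_at_top[of "nat m"]
    by eventually_elim (rule fls_vanish_mono[OF assms], simp)
qed

section \<open>Continuity of addition, multiplication and inversion\<close>

instance fls :: (ab_group_add) topological_comm_monoid_add
proof
  fix a b :: "'a fls"
  have "((\<lambda>x. fst x + snd x) \<longlongrightarrow> a + b) (nhds a \<times>\<^sub>F nhds b)"
    unfolding tendsto_fls_iff
  proof
    fix m
    have "eventually (\<lambda>x. fls_vanish m (x - a)) (nhds a)" "eventually (\<lambda>x. fls_vanish m (x - b)) (nhds b)"
      by (rule eventually_fls_vanish_nhds)+
    then have "eventually (\<lambda>x. fls_vanish m (fst x - a) \<and> fls_vanish m (snd x - b)) (nhds a \<times>\<^sub>F nhds b)"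
      by (rule eventually_prodI)
    then show "eventually (\<lambda>x. fls_vanish m (fst x + snd x - (a + b))) (nhds a \<times>\<^sub>F nhds b)"
    proof eventually_elim
      case (elim x)
      then have "fls_vanish m ((fst x - a) + (snd x - b))" by (auto intro: fls_vanish_add)
      then show ?case by (simp add: algebra_simps)
    qed
  qed
  then show "((\<lambda>x. fst x + snd x) \<longlongrightarrow> a + b) (nhds a \<times>\<^sub>F nhds b)" .
qed

instance fls :: (comm_ring_1) topological_semigroup_mult
proof
  fix a b :: "'a fls"
  define c where "c = min 0 (min (fls_subdegree a) (fls_subdegree b))"
  have c: "fls_vanish c a" "fls_vanish c b" "c \<le> 0"
    by (auto simp: fls_vanish_iff c_def)
  show "((\<lambda>x. fst x * snd x) \<longlongrightarrow> a * b) (nhds a \<times>\<^sub>F nhds b)"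
    unfolding tendsto_fls_iff
  proof
    fix m
    \<comment> \<open>The entry \<open>m - c\<close> makes up for a pole of order at most
      \<open>- c\<close> in the other factor, and \<open>k \<ge> c\<close> ensures that
      \<open>snd x\<close>, which only approaches \<open>b\<close>, has no worse pole than
      \<open>c\<close> allows.\<close>
    define k where "k = max c (m - c)"
    have "eventually (\<lambda>x. fls_vanish k (x - a)) (nhds a)" "eventually (\<lambda>x. fls_vanish k (x - b)) (nhds b)"
      by (rule eventually_fls_vanish_nhds)+
    then have "eventually (\<lambda>x. fls_vanish k (fst x - a) \<and> fls_vanish k (snd x - b)) (nhds a \<times>\<^sub>F nhds b)"
      by (rule eventually_prodI)
    then show "eventually (\<lambda>x. fls_vanish m (fst x * snd x - a * b)) (nhds a \<times>\<^sub>F nhds b)"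
    proof eventually_elim
      case (elim x)
      have "fls_vanish c (snd x)"
        using fls_vanish_add[OF fls_vanish_mono[of k "snd x - b" c] c(2)] elim by (simp add: k_def)
      then have "fls_vanish (k + c) ((fst x - a) * snd x + (snd x - b) * a)"
        using elim c by (auto intro!: fls_vanish_add fls_vanish_mult)
      then show ?case
        by (intro fls_vanish_mono[of "k + c" _ m]) (simp_all add: algebra_simps k_def)
    qed
  qed
qed

text \<open>Agreement with g through its subdegree s forces f x to have the same subdegree. The
  difference of the inverses is (g - f x) / (f x * g), whose denominator costs 2 s orders; hence the
  threshold \<open>m + 2 * s\<close>.\<close>

lemma tendsto_inverse_fls:
  fixes f :: "'b \<Rightarrow> 'a::field fls"
  assumes "(f \<longlongrightarrow> g) F" "g \<noteq> 0"
  shows "((\<lambda>x. inverse (f x)) \<longlongrightarrow> inverse g) F"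
  unfolding tendsto_fls_iff
proof
  fix m
  define s where "s = fls_subdegree g"
  have "eventually (\<lambda>x. fls_vanish (s + 1) (f x - g)) F" "eventually (\<lambda>x. fls_vanish (m + 2 * s) (f x - g)) F"
    using assms(1) unfolding tendsto_fls_iff by blast+
  then show "eventually (\<lambda>x. fls_vanish m (inverse (f x) - inverse g)) F"
  proof eventually_elim
    case (elim x)
    have "f x $$ s = g $$ s" using fls_vanishD[OF elim(1), of s] by simp
    then have nz: "f x \<noteq> 0" using assms(2) by (auto simp: s_def)
    have "f x $$ i = 0" if "i < s" for i
      using fls_vanishD[OF elim(1), of i] that by (simp add: s_def)
    then have sf: "fls_subdegree (f x) = s"
      using \<open>f x $$ s = g $$ s\<close> assms(2) by (intro fls_subdegree_eqI) (auto simp: s_def)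
    have "fls_vanish (m + 2 * s + (- s) + (- s)) ((g - f x) * inverse (f x) * inverse g)"
      using elim(2) nz assms(2) sf
      by (intro fls_vanish_mult) (auto simp: fls_vanish_iff[of "- fls_subdegree g"] s_def fls_vanish_diff_commute[of _ g])
    moreover have "(g - f x) * inverse (f x) * inverse g = inverse (f x) - inverse g"
      using nz assms(2) by (simp add: field_simps)
    ultimately show ?case by simp
  qed
qed

lemma tendsto_divide_fls:
  fixes f h :: "'b \<Rightarrow> 'a::field fls"
  assumes "(f \<longlongrightarrow> a) F" "(h \<longlongrightarrow> b) F" "b \<noteq> 0"
  shows "((\<lambda>x. f x / h x) \<longlongrightarrow> a / b) F"
  using tendsto_mult[OF assms(1) tendsto_inverse_fls[OF assms(2,3)]] by (simp add: field_simps)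

section \<open>Criteria for the convergence of sequences, unordered sums and products\<close>

lemma fls_sequence_convergentI:
  fixes f :: "nat \<Rightarrow> 'a::ab_group_add fls"
  assumes "\<And>n. fls_vanish (int n) (f (Suc n) - f n)"
  shows "\<exists>L. f \<longlonglongrightarrow> L \<and> (\<forall>n. fls_vanish (int n) (f n - L))"
proof -
  have ge: "fls_vanish (int n) (f (n + k) - f n)" for n k
  proof (induction k)
    case (Suc k)
    have "fls_vanish (int n) (f (Suc (n + k)) - f (n + k))"
      by (rule fls_vanish_mono[OF assms]) simp
    from fls_vanish_diff_trans[OF this Suc.IH] show ?case by simp
  qed simp
  \<comment> \<open>Coefficient \<open>i\<close> no longer changes from index \<open>Suc i\<close>
    on, so the limit is read off along the diagonal. Subtracting \<open>f 0\<close> leaves a power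
    series whatever poles \<open>f 0\<close> has, because \<open>ge\<close> at index 0 covers all
    negative exponents.\<close>
  define L where "L = f 0 + fps_to_fls (Abs_fps (\<lambda>i. (f (Suc i) - f 0) $$ int i))"
  have L: "fls_vanish (int n) (f n - L)" for n
  proof (rule fls_vanishI)
    fix i assume i: "i < int n"
    show "(f n - L) $$ i = 0"
    proof (cases "i < 0")
      case True
      then have "(f n - f 0) $$ i = 0" using fls_vanishD[OF ge[of 0 n], of i] by simp
      then show ?thesis using True by (simp add: L_def)
    next
      case False
      define j where "j = nat i"
      have j: "i = int j" using False by (simp add: j_def)
      have "(f (Suc j + (n - Suc j)) - f (Suc j)) $$ i = 0"
        by (rule fls_vanishD[OF ge]) (simp add: j)
      then show ?thesis using i by (simp add: L_def j)
    qed
  qed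
  show ?thesis using tendsto_fls_offsetI[of f L, OF L] L by blast
qed

text \<open>Modulo q^m only a finite set of summands matters, so all finite sets containing it have
  the same sum. A single exhausting sequence \<open>B\<close> therefore determines the value of the
  unordered sum.\<close>

lemma has_sum_flsI:
  fixes f :: "'b \<Rightarrow> 'a::ab_group_add fls"
  assumes lim: "(\<lambda>N. sum f (B N)) \<longlonglongrightarrow> S"
    and B: "\<And>N. finite (B N)" "\<And>N. B N \<subseteq> A" "\<And>x. x \<in> A \<Longrightarrow> eventually (\<lambda>N. x \<in> B N) sequentially"
    and fin: "\<And>m. finite {x\<in>A. \<not> fls_vanish m (f x)}"
  shows "(f has_sum S) A"
  unfolding has_sum_def tendsto_fls_iff
proof
  fix m
  define E where "E = {x\<in>A. \<not> fls_vanish m (f x)}"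
  have "finite E" using fin by (simp add: E_def)
  have "eventually (\<lambda>N. \<forall>x\<in>E. x \<in> B N) sequentially"
    using B(3) \<open>finite E\<close> by (intro eventually_ball_finite) (auto simp: E_def)
  moreover have "eventually (\<lambda>N. fls_vanish m (sum f (B N) - S)) sequentially"
    using lim unfolding tendsto_fls_iff by blast
  ultimately have "eventually (\<lambda>N. E \<subseteq> B N \<and> fls_vanish m (sum f (B N) - S)) sequentially"
    by eventually_elim auto
  then obtain N where N: "E \<subseteq> B N" "fls_vanish m (sum f (B N) - S)"
    by (auto simp: eventually_sequentially)
  have out: "fls_vanish m (sum f C - sum f E)" if "finite C" "E \<subseteq> C" "C \<subseteq> A" for C
  proof -
    have "sum f C = sum f (C - E) + sum f E" using that by (intro sum.subset_diff) auto
    moreover have "fls_vanish m (sum f (C - E))"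
      using that by (intro fls_vanish_sum) (auto simp: E_def)
    ultimately show ?thesis by simp
  qed
  show "eventually (\<lambda>C. fls_vanish m (sum f C - S)) (finite_subsets_at_top A)"
    unfolding eventually_finite_subsets_at_top
  proof (intro exI[of _ E] conjI allI impI)
    fix C assume C: "finite C \<and> E \<subseteq> C \<and> C \<subseteq> A"
    then have "fls_vanish m (sum f C - sum f (B N))"
      using fls_vanish_diff_trans[of m "sum f C" "sum f E" "sum f (B N)"] out[of C] out[of "B N"] B N(1)
        fls_vanish_diff_commute[of m "sum f E"] by simp
    then show "fls_vanish m (sum f C - S)" using N(2) by (rule fls_vanish_diff_trans)
  qed (use \<open>finite E\<close> in \<open>auto simp: E_def\<close>)
qed

text \<open>A nonzero limit is part of what \<open>has_prod\<close> asserts here. From index n on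
  all partial products are 1 modulo q, so the limit of this tail has constant coefficient 1; the
  first n factors, which may have poles, contribute a fixed nonzero factor.\<close>

lemma has_prod_flsI:
  fixes f :: "nat \<Rightarrow> 'a::field fls"
  assumes f: "\<And>t. fls_vanish (int t + 1) (f (t + n) - 1)" and nz: "\<And>t. t < n \<Longrightarrow> f t \<noteq> 0"
  obtains L where "(\<lambda>N. \<Prod>t<N. f t) \<longlonglongrightarrow> L" "L \<noteq> 0" "f has_prod L"
proof -
  let ?P = "\<lambda>N. \<Prod>t<N. f (t + n)"
  have 0: "fls_vanish 0 (f (t + n))" for t
    using fls_vanish_add[OF fls_vanish_mono[OF f[of t], of 0] fls_vanish_1] by simp
  have step: "fls_vanish (int N) (?P (Suc N) - ?P N)" for N
  proof -
    have "?P (Suc N) - ?P N = ?P N * (f (N + n) - 1)" by (simp add: algebra_simps)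
    moreover have "fls_vanish (int N) (f (N + n) - 1)" by (rule fls_vanish_mono[OF f]) simp
    ultimately show ?thesis using 0 by (simp add: fls_vanish_mult_left fls_vanish_prod)
  qed
  obtain L where L: "?P \<longlonglongrightarrow> L" "\<And>N. fls_vanish (int N) (?P N - L)"
    using fls_sequence_convergentI[of ?P, OF step] by blast
  have "fls_vanish 1 (?P 1 - 1)"
    using f[of 0] by simp
  moreover have "fls_vanish 1 (L - ?P 1)"
    using L(2)[of 1] fls_vanish_diff_commute[of 1 L] by simp
  ultimately have "fls_vanish 1 (L - 1)" by (rule fls_vanish_diff_trans[rotated])
  then have "L \<noteq> 0" using fls_vanishD[of 1 "L - 1" 0] by auto
  let ?c = "\<Prod>t<n. f t"
  have split: "(\<Prod>t<N + n. f t) = ?c * ?P N" for N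
    by (induction N) (simp_all add: mult.assoc)
  have "(\<lambda>N. ?c * ?P N) \<longlonglongrightarrow> ?c * L" by (intro tendsto_mult tendsto_const L(1))
  then have lim: "(\<lambda>N. \<Prod>t<N. f t) \<longlonglongrightarrow> ?c * L"
    unfolding split[symmetric] by (rule LIMSEQ_offset)
  have "?c * L \<noteq> 0" using \<open>L \<noteq> 0\<close> nz by simp
  moreover have "f has_prod (?c * L)"
    unfolding has_prod_def raw_has_prod_def
    using LIMSEQ_Suc[OF lim] \<open>?c * L \<noteq> 0\<close> by (simp add: lessThan_Suc_atMost)
  ultimately show ?thesis using lim that by blast
qed

section \<open>A finite form of Bailey's lemma\<close>

text \<open>
  In the notation of the paper the next three definitions are $(q)_n$, $(-dq)_n$ and
  $d^n(-1/d)_n$; the last one is written without a division by $d$.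
\<close>

definition qfact :: "'a::field \<Rightarrow> nat \<Rightarrow> 'a" where
  "qfact q n = (\<Prod>k<n. 1 - q ^ Suc k)"

definition qprod :: "'a::field \<Rightarrow> 'a \<Rightarrow> nat \<Rightarrow> 'a" where
  "qprod q d n = (\<Prod>k<n. 1 + d * q ^ Suc k)"

definition qshift :: "'a::field \<Rightarrow> 'a \<Rightarrow> nat \<Rightarrow> 'a" where
  "qshift q d n = (\<Prod>k<n. d + q ^ k)"

text \<open>
  The formula for $r>0$ is the sum of the contributions of $r$ and $-r$ to a bilateral sum, so that
  at $r=0$ it would give twice the value of $\alpha_0$.
\<close>

definition bailey_alpha :: "'a::field \<Rightarrow> 'a \<Rightarrow> 'a \<Rightarrow> nat \<Rightarrow> 'a" where
  "bailey_alpha q d e r = (if r = 0 then 1 else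
     (- 1) ^ r * q ^ (\<Sum>{..r}) * (1 + q ^ r) * (qshift q d r * qshift q e r) /
       (qprod q d r * qprod q e r))"

lemma qfact_0 [simp]: "qfact q 0 = 1"
  and qfact_Suc: "qfact q (Suc n) = qfact q n * (1 - q ^ Suc n)"
  by (simp_all add: qfact_def)

lemma qprod_0 [simp]: "qprod q d 0 = 1"
  and qprod_Suc: "qprod q d (Suc n) = qprod q d n * (1 + d * q ^ Suc n)"
  by (simp_all add: qprod_def)

lemma qshift_0 [simp]: "qshift q d 0 = 1"
  and qshift_Suc: "qshift q d (Suc n) = qshift q d n * (d + q ^ n)"
  by (simp_all add: qshift_def)

lemma qfact_nonzero: "(\<And>n. n > 0 \<Longrightarrow> q ^ n \<noteq> 1) \<Longrightarrow> qfact q n \<noteq> 0"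
  unfolding qfact_def by (auto simp del: power_Suc)

lemma qprod_nonzero: "(\<And>n. n > 0 \<Longrightarrow> 1 + d * q ^ n \<noteq> 0) \<Longrightarrow> qprod q d n \<noteq> 0"
  unfolding qprod_def by (auto simp del: power_Suc)

text \<open>
  The induction step from $r$ to $r+1$ in the proof of \<open>bailey_certificate\<close>, where $x=q^{r+1}$ and
  $xz=q^{n+1}$; the other letters stand for the factors that cancel.
\<close>

lemma bailey_certificate_step:
  fixes B :: "'a::field"
  assumes nz: "B \<noteq> 0" "D \<noteq> 0" "Q \<noteq> 0" "R \<noteq> 0" "Z \<noteq> 0" "W \<noteq> 0" "P \<noteq> 0" "S \<noteq> 0"
  assumes key: "(1 + x) * (c - k * Z * W) = x * z * (F * Z) + z * (P * S * W)"
  shows "s * t * (x * z) * N / (B * D * (Q * Z * R))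
     + (c * (- s * (t * x) * (1 + x) * N / (B * P * (D * S)) / (Q * Z * (R * W)))
        - k * (- s * (t * x) * (1 + x) * N / (B * P * (D * S)) / (Q * R)))
     = - s * (t * x) * (x * z) * (N * F) / (B * P * (D * S) * (Q * (R * W)))"
proof -
  define K where "K = s * t * x * N / (B * D * P * S * Q * R * Z * W)"
  have "s * t * (x * z) * N / (B * D * (Q * Z * R)) = K * (z * (P * S * W))"
    using nz by (simp add: K_def field_simps)
  moreover have "c * (- s * (t * x) * (1 + x) * N / (B * P * (D * S)) / (Q * Z * (R * W))) = - K * ((1 + x) * c)"
    using nz by (simp add: K_def field_simps)
  moreover have "k * (- s * (t * x) * (1 + x) * N / (B * P * (D * S)) / (Q * R)) = - K * ((1 + x) * (k * Z * W))"
    using nz by (simp add: K_def field_simps)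
  moreover have "- s * (t * x) * (x * z) * (N * F) / (B * P * (D * S) * (Q * (R * W))) = - K * (x * z * (F * Z))"
    using nz by (simp add: K_def field_simps)
  moreover have "K * (z * (P * S * W)) + (- K * ((1 + x) * c) - - K * ((1 + x) * (k * Z * W)))
      = - K * (x * z * (F * Z))"
    using arg_cong[OF key, of "\<lambda>y. K * y"] by (simp add: algebra_simps)
  ultimately show ?thesis by simp
qed

context
  fixes q d e :: "'a::field"
  assumes q: "\<And>n. n > 0 \<Longrightarrow> q ^ n \<noteq> 1"
    and d: "\<And>n. n > 0 \<Longrightarrow> 1 + d * q ^ n \<noteq> 0"
    and e: "\<And>n. n > 0 \<Longrightarrow> 1 + e * q ^ n \<noteq> 0"
begin

text \<open>
  Both sides of \<open>bailey_pair\<close> satisfy a recurrence of first order in $n$.  For the sum it holds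
  because the difference of the two sides of the recurrence telescopes in $r$ with the certificate
  on the right-hand side.
\<close>

lemma bailey_certificate:
  assumes "r \<le> n"
  defines "M \<equiv> q ^ Suc n"
  shows "(\<Sum>i\<le>r. (1 - M) * (1 + d * M) * (1 + e * M)
             * (bailey_alpha q d e i / (qfact q (Suc n - i) * qfact q (Suc n + i)))
           - (1 - d * e * M) * (bailey_alpha q d e i / (qfact q (n - i) * qfact q (n + i))))
       = (- 1) ^ r * q ^ (\<Sum>{..r}) * M * (qshift q d (Suc r) * qshift q e (Suc r)) /
           (qprod q d r * qprod q e r * (qfact q (n - r) * qfact q (Suc n + r)))"
  using \<open>r \<le> n\<close>
proof (induction r)
  case 0
  \<comment> \<open>With alpha_0 = 1 the claim reduces to (1 + d M)(1 + e M) - (1 - d e M)(1 - M) =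
    M (1 + d)(1 + e).\<close>
  have "1 - M \<noteq> 0" "qfact q n \<noteq> 0" using q[of "Suc n"] qfact_nonzero[OF q] unfolding M_def by auto
  then show ?case
    by (simp add: bailey_alpha_def qfact_Suc qshift_Suc divide_simps flip: power_Suc M_def)
       (simp add: algebra_simps)
next
  case (Suc r)
  obtain j where n: "n = Suc r + j" using Suc.prems le_Suc_ex by blast
  define x z where "x = q ^ Suc r" and "z = q ^ Suc j"
  have M: "M = x * z" by (simp add: M_def x_def z_def n power_add)
  have Mx: "q ^ Suc (n + Suc r) = M * x" by (simp add: M_def x_def power_add)
  have nz: "qprod q d r \<noteq> 0" "qprod q e r \<noteq> 0" "qfact q j \<noteq> 0" "qfact q (n + Suc r) \<noteq> 0"
    using qprod_nonzero[OF d] qprod_nonzero[OF e] qfact_nonzero[OF q] by auto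
  have nz2: "1 - z \<noteq> 0" "1 - M * x \<noteq> 0" "1 + d * x \<noteq> 0" "1 + e * x \<noteq> 0"
    using q[of "Suc j"] q[of "Suc (n + Suc r)"] d[of "Suc r"] e[of "Suc r"]
    unfolding z_def[symmetric] x_def[symmetric] Mx by auto
  \<comment> \<open>Once the common shifted factorials are cancelled, the telescoping step is this
    polynomial identity in d, e, x and z.\<close>
  have key: "(1 + x) * ((1 - M) * (1 + d * M) * (1 + e * M) - (1 - d * e * M) * (1 - z) * (1 - M * x))
     = x * z * ((d + x) * (e + x) * (1 - z)) + z * ((1 + d * x) * (1 + e * x) * (1 - M * x))"
    unfolding M by algebra
  have eqs: "n - r = Suc j" "Suc n - Suc r = Suc j" "n - Suc r = j" "Suc n + r = n + Suc r"
    "Suc n + Suc r = Suc (n + Suc r)"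
    by (simp_all add: n)
  have alpha: "bailey_alpha q d e (Suc r) = - ((-1) ^ r) * (q ^ (\<Sum>{..r}) * x) * (1 + x)
      * (qshift q d (Suc r) * qshift q e (Suc r)) / (qprod q d r * (1 + d * x) * (qprod q e r * (1 + e * x)))"
    by (simp add: bailey_alpha_def qprod_Suc x_def power_add)
  have qs: "qshift q d (Suc (Suc r)) * qshift q e (Suc (Suc r)) =
     qshift q d (Suc r) * qshift q e (Suc r) * ((d + x) * (e + x))"
    by (simp add: qshift_Suc x_def)
  have G: "(- 1) ^ Suc r * q ^ (\<Sum>{..Suc r}) = - ((-1) ^ r) * (q ^ (\<Sum>{..r}) * x)"
    by (simp add: x_def power_add)
  have ih: "(\<Sum>i\<le>r. (1 - M) * (1 + d * M) * (1 + e * M)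
             * (bailey_alpha q d e i / (qfact q (Suc n - i) * qfact q (Suc n + i)))
           - (1 - d * e * M) * (bailey_alpha q d e i / (qfact q (n - i) * qfact q (n + i))))
     = (- 1) ^ r * q ^ (\<Sum>{..r}) * (x * z) * (qshift q d (Suc r) * qshift q e (Suc r)) /
           (qprod q d r * qprod q e r * (qfact q j * (1 - z) * qfact q (n + Suc r)))"
    using Suc.IH Suc.prems unfolding eqs qfact_Suc[of q j] z_def[symmetric] M[symmetric] by simp
  show ?case
    unfolding G unfolding sum.atMost_Suc ih
    unfolding eqs alpha qs qfact_Suc[of q j] qfact_Suc[of q "n + Suc r"] z_def[symmetric] Mx
      qprod_Suc[of _ _ r] x_def[symmetric]
    using bailey_certificate_step[OF nz nz2 key, of "(- 1) ^ r" "q ^ (\<Sum>{..r})"]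
    by (simp only: M mult.assoc)
qed

text \<open>Passing from n to n + 1 multiplies both sides by (1 - d e M) / ((1 - M)(1 + d M)(1 + e
  M)) with M = q^(n+1). In hypergeometric terms this is the terminating very-well-poised 6phi5 sum
  at a = 1.\<close>

lemma bailey_pair:
  "(\<Sum>r\<le>n. bailey_alpha q d e r / (qfact q (n - r) * qfact q (n + r)))
     = qprod q (- (d * e)) n / (qfact q n * qprod q d n * qprod q e n)"
proof (induction n)
  case 0
  show ?case by (simp add: bailey_alpha_def)
next
  case (Suc n)
  define M where "M = q ^ Suc n"
  define c where "c = (1 - M) * (1 + d * M) * (1 + e * M)"
  let ?U = "\<lambda>n r. bailey_alpha q d e r / (qfact q (n - r) * qfact q (n + r))"
  have M2: "q ^ Suc (n + Suc n) = M * M" by (simp add: M_def power_add)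
  have nzc: "1 - M \<noteq> 0" "1 + d * M \<noteq> 0" "1 + e * M \<noteq> 0" "1 - M * M \<noteq> 0"
    using q[of "Suc n"] d[of "Suc n"] e[of "Suc n"] q[of "Suc (n + Suc n)"] unfolding M_def[symmetric] M2 by auto
  have nz: "qprod q d n \<noteq> 0" "qprod q e n \<noteq> 0" "qfact q n \<noteq> 0" "qfact q (n + Suc n) \<noteq> 0"
    using qprod_nonzero[OF d] qprod_nonzero[OF e] qfact_nonzero[OF q] by auto
  have 1: "c * (\<Sum>r\<le>n. ?U (Suc n) r) - (1 - d * e * M) * (\<Sum>r\<le>n. ?U n r)
    = (- 1) ^ n * q ^ (\<Sum>{..n}) * M * (qshift q d (Suc n) * qshift q e (Suc n)) /
           (qprod q d n * qprod q e n * qfact q (n + Suc n))"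
    using bailey_certificate[of n n]
    by (simp add: sum_subtractf sum_distrib_left c_def M_def)
  \<comment> \<open>The old sum ends at r = n, so the index n + 1 occurs in the new sum only. Its
    single term cancels the boundary term that the certificate leaves at r = n.\<close>
  have 2: "c * ?U (Suc n) (Suc n) = - ((- 1) ^ n * q ^ (\<Sum>{..n}) * M * (qshift q d (Suc n) * qshift q e (Suc n)) /
           (qprod q d n * qprod q e n * qfact q (n + Suc n)))"
  proof -
    have u: "?U (Suc n) (Suc n) = - ((-1) ^ n) * (q ^ (\<Sum>{..n}) * M) * (1 + M) * (qshift q d (Suc n) * qshift q e (Suc n)) /
      (qprod q d n * (1 + d * M) * (qprod q e n * (1 + e * M))) / (qfact q (n + Suc n) * (1 - M * M))"
      using qfact_Suc[of q "n + Suc n"] unfolding M2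
      by (simp add: bailey_alpha_def qprod_Suc M_def power_add)
    have sq: "1 - M * M = (1 - M) * (1 + M)" by (simp add: algebra_simps)
    have "1 + M \<noteq> 0" using nzc unfolding sq by auto
    then show ?thesis
      unfolding u c_def sq using nz nzc by (simp add: mult.assoc)
  qed
  have "c * (\<Sum>r\<le>Suc n. ?U (Suc n) r) = (1 - d * e * M) * (\<Sum>r\<le>n. ?U n r)"
    unfolding sum.atMost_Suc distrib_left 2 using 1 by (simp add: algebra_simps)
  then have "(\<Sum>r\<le>Suc n. ?U (Suc n) r) = (1 - d * e * M) * (\<Sum>r\<le>n. ?U n r) / c"
    using nonzero_mult_div_cancel_left[of c "\<Sum>r\<le>Suc n. ?U (Suc n) r"] nzc by (simp add: c_def)
  also have "\<dots> = qprod q (- (d * e)) (Suc n) / (qfact q (Suc n) * qprod q d (Suc n) * qprod q e (Suc n))"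
    unfolding Suc.IH qprod_Suc qfact_Suc M_def[symmetric] c_def using nz nzc
    by (simp add: divide_simps)
  finally show ?case .
qed

text \<open>The ratio of consecutive summands is that of a summable ${}_2\phi_1$ with $c=abq$.\<close>

lemma conjugate_bailey_sum:
  assumes "r > 0"
  shows "(\<Sum>i\<le>j. (qfact q (r + i - 1))\<^sup>2 * q ^ (r + i) / (qfact q i * qfact q (2 * r + i)))
     = q ^ r / (1 - q ^ r)\<^sup>2 * ((qfact q (r + j))\<^sup>2 / (qfact q j * qfact q (2 * r + j)))"
proof (induction j)
  case 0
  \<comment> \<open>The relation (q)_r = (q)_(r-1) (1 - q^r) produces the denominator (1 - q^r)^2;
    for r > 0 the index r - 1 is a true predecessor.\<close>
  obtain s where "r = Suc s" using assms gr0_conv_Suc by auto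
  then show ?case
    using q[OF assms] by (simp add: qfact_Suc power_mult_distrib del: power_Suc)
next
  case (Suc j)
  define x y where "x = q ^ r" and "y = q ^ Suc j"
  have eqs: "r + Suc j - 1 = r + j" "r + Suc j = Suc (r + j)" "2 * r + Suc j = Suc (2 * r + j)"
    by simp_all
  have pw: "q ^ Suc (r + j) = x * y" "q ^ Suc (2 * r + j) = x * x * y"
    by (simp_all add: x_def y_def power_add mult_2)
  have nz: "1 - x \<noteq> 0" "1 - y \<noteq> 0" "1 - x * x * y \<noteq> 0"
    using q[of r] q[of "Suc j"] q[of "Suc (2 * r + j)"] assms unfolding pw x_def y_def by auto
  have nz2: "qfact q j \<noteq> 0" "qfact q (2 * r + j) \<noteq> 0"
    using qfact_nonzero[OF q] by auto
  have *: "x / (1 - x)\<^sup>2 * (F\<^sup>2 / (a * b)) + F\<^sup>2 * (x * y) / (a * (1 - y) * (b * (1 - x * x * y)))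
      = x / (1 - x)\<^sup>2 * ((F * (1 - x * y))\<^sup>2 / (a * (1 - y) * (b * (1 - x * x * y))))"
    if "a \<noteq> 0" "b \<noteq> 0" for F a b :: 'a
  proof -
    define K where "K = x * F\<^sup>2 / ((1 - x)\<^sup>2 * a * b * (1 - y) * (1 - x * x * y))"
    have "x / (1 - x)\<^sup>2 * (F\<^sup>2 / (a * b)) = K * ((1 - y) * (1 - x * x * y))"
      using nz that by (simp add: K_def mult_ac)
    moreover have "F\<^sup>2 * (x * y) / (a * (1 - y) * (b * (1 - x * x * y))) = K * (y * (1 - x)\<^sup>2)"
      using nz that by (simp add: K_def mult_ac)
    moreover have "x / (1 - x)\<^sup>2 * ((F * (1 - x * y))\<^sup>2 / (a * (1 - y) * (b * (1 - x * x * y)))) = K * (1 - x * y)\<^sup>2"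
      using nz that by (simp add: K_def power_mult_distrib mult_ac)
    moreover have "(1 - y) * (1 - x * x * y) + y * (1 - x)\<^sup>2 = (1 - x * y)\<^sup>2"
      by algebra
    ultimately show ?thesis by (metis distrib_left)
  qed
  show ?case
    unfolding sum.atMost_Suc Suc.IH unfolding eqs qfact_Suc pw y_def[symmetric] x_def[symmetric]
    using *[OF nz2, of "qfact q (r + j)"] by simp
qed

text \<open>Inserting \<open>bailey_pair\<close> and exchanging the finite sums leaves, for r >= 1,
  a sum over n from r to N, which the conjugate identity evaluates with j = N - r. For r = 0 nothing
  telescopes: (q)_(n-1)^2 / (q)_n^2 is 1 / (1 - q^n)^2 by itself.\<close>

lemma bailey_transform_finite:
  "(\<Sum>n=1..N. qfact q (n - 1) ^ 2 * q ^ n * (qprod q (- (d * e)) n / (qfact q n * qprod q d n * qprod q e n)))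
   = (\<Sum>n=1..N. q ^ n / (1 - q ^ n)\<^sup>2) +
     (\<Sum>r=1..N. bailey_alpha q d e r * (q ^ r / (1 - q ^ r)\<^sup>2)
        * (qfact q N ^ 2 / (qfact q (N - r) * qfact q (N + r))))"
proof -
  let ?V = "\<lambda>n r. qfact q (n - 1) ^ 2 * q ^ n / (qfact q (n - r) * qfact q (n + r))"
  have "(\<Sum>n=1..N. qfact q (n - 1) ^ 2 * q ^ n * (qprod q (- (d * e)) n / (qfact q n * qprod q d n * qprod q e n)))
     = (\<Sum>n=1..N. \<Sum>r\<le>n. bailey_alpha q d e r * ?V n r)"
    unfolding bailey_pair[symmetric] sum_distrib_left by (intro sum.cong refl) simp
  also have "\<dots> = (\<Sum>n=1..N. ?V n 0 + (\<Sum>r=1..n. bailey_alpha q d e r * ?V n r))"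
  proof (intro sum.cong refl)
    fix n :: nat
    have "{..n} = insert 0 {1..n}" by (auto simp: Suc_le_eq)
    then show "(\<Sum>r\<le>n. bailey_alpha q d e r * ?V n r) = ?V n 0 + (\<Sum>r=1..n. bailey_alpha q d e r * ?V n r)"
      by (simp add: bailey_alpha_def)
  qed
  also have "\<dots> = (\<Sum>n=1..N. ?V n 0) + (\<Sum>n=1..N. \<Sum>r=1..n. bailey_alpha q d e r * ?V n r)"
    by (rule sum.distrib)
  also have "(\<Sum>n=1..N. ?V n 0) = (\<Sum>n=1..N. q ^ n / (1 - q ^ n)\<^sup>2)"
  proof (intro sum.cong refl)
    fix n assume "n \<in> {1..N}"
    then obtain m where n: "n = Suc m" by (cases n) auto
    have "qfact q m \<noteq> 0" "1 - q ^ n \<noteq> 0" using qfact_nonzero[OF q] q[of n] n by auto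
    then show "?V n 0 = q ^ n / (1 - q ^ n)\<^sup>2"
      by (simp add: n qfact_Suc power2_eq_square del: power_Suc)
  qed
  also have "(\<Sum>n=1..N. \<Sum>r=1..n. bailey_alpha q d e r * ?V n r)
      = (\<Sum>r=1..N. \<Sum>n=r..N. bailey_alpha q d e r * ?V n r)"
    unfolding sum.Sigma[OF finite_atLeastAtMost ballI[OF finite_atLeastAtMost]]
    by (rule sum.reindex_bij_witness[of _ "\<lambda>(a, b). (b, a)" "\<lambda>(a, b). (b, a)"]) auto
  also have "\<dots> = (\<Sum>r=1..N. bailey_alpha q d e r * (q ^ r / (1 - q ^ r)\<^sup>2)
        * (qfact q N ^ 2 / (qfact q (N - r) * qfact q (N + r))))"
  proof (intro sum.cong refl)
    fix r assume r: "r \<in> {1..N}"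
    then obtain j where N: "N = r + j" using le_Suc_ex by auto
    have "(\<Sum>n=r..N. bailey_alpha q d e r * ?V n r) = bailey_alpha q d e r * (\<Sum>n=r..N. ?V n r)"
      by (rule sum_distrib_left[symmetric])
    also have "(\<Sum>n=r..N. ?V n r) = (\<Sum>i\<le>j. (qfact q (r + i - 1))\<^sup>2 * q ^ (r + i) / (qfact q i * qfact q (2 * r + i)))"
      by (rule sum.reindex_bij_witness[of _ "\<lambda>i. r + i" "\<lambda>n. n - r"]) (auto simp: N mult_2 ac_simps)
    also have "\<dots> = q ^ r / (1 - q ^ r)\<^sup>2 * ((qfact q (r + j))\<^sup>2 / (qfact q j * qfact q (2 * r + j)))"
      using r by (intro conjugate_bailey_sum) auto
    finally show "(\<Sum>n=r..N. bailey_alpha q d e r * ?V n r) = bailey_alpha q d e r * (q ^ r / (1 - q ^ r)\<^sup>2)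
        * (qfact q N ^ 2 / (qfact q (N - r) * qfact q (N + r)))"
      by (simp add: N mult_2 ac_simps flip: mult_2_right)
  qed
  finally show ?thesis .
qed

end

section \<open>Generating functions of graded sets\<close>

definition gen_fun :: "'b set \<Rightarrow> ('b \<Rightarrow> nat) \<Rightarrow> ('b \<Rightarrow> 'a::comm_ring_1) \<Rightarrow> 'a fps" where
  "gen_fun A deg w = Abs_fps (\<lambda>n. \<Sum>x\<in>{x\<in>A. deg x = n}. w x)"

text \<open>A sum over an infinite set is 0 by convention, so the union and product rules for
  \<open>gen_fun\<close> need every coefficient to be a genuinely finite sum.\<close>

definition finite_fibres :: "'b set \<Rightarrow> ('b \<Rightarrow> nat) \<Rightarrow> bool" where
  "finite_fibres A deg \<longleftrightarrow> (\<forall>n. finite {x\<in>A. deg x = n})"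

lemma finite_fibres_subset: "finite_fibres A deg \<Longrightarrow> B \<subseteq> A \<Longrightarrow> finite_fibres B deg"
  unfolding finite_fibres_def
proof
  fix n assume "\<forall>n. finite {x\<in>A. deg x = n}" "B \<subseteq> A"
  then show "finite {x\<in>B. deg x = n}"
    by (elim allE[of _ n] finite_subset[rotated]) auto
qed

lemma gen_fun_nth: "gen_fun A deg w $ n = (\<Sum>x\<in>{x\<in>A. deg x = n}. w x)"
  by (simp add: gen_fun_def)

lemma gen_fun_add: "gen_fun A deg (\<lambda>x. v x + w x) = gen_fun A deg v + gen_fun A deg w"
  by (rule fps_ext) (simp add: gen_fun_nth sum.distrib)

lemma gen_fun_Un_disjoint:
  assumes "finite_fibres A deg" "finite_fibres B deg" "A \<inter> B = {}"
  shows "gen_fun (A \<union> B) deg w = gen_fun A deg w + gen_fun B deg w"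
proof (rule fps_ext)
  fix n
  have "{x \<in> A \<union> B. deg x = n} = {x\<in>A. deg x = n} \<union> {x\<in>B. deg x = n}" by auto
  moreover have "(\<Sum>x\<in>{x\<in>A. deg x = n} \<union> {x\<in>B. deg x = n}. w x)
      = (\<Sum>x\<in>{x\<in>A. deg x = n}. w x) + (\<Sum>x\<in>{x\<in>B. deg x = n}. w x)"
    using assms by (intro sum.union_disjoint) (auto simp: finite_fibres_def)
  ultimately show "gen_fun (A \<union> B) deg w $ n = (gen_fun A deg w + gen_fun B deg w) $ n"
    by (simp add: gen_fun_nth)
qed

lemma gen_fun_reindex:
  assumes "bij_betw h A B" "\<And>x. x \<in> A \<Longrightarrow> deg' (h x) = deg x" "\<And>x. x \<in> A \<Longrightarrow> w' (h x) = w x"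
  shows "gen_fun B deg' w' = gen_fun A deg w"
proof (rule fps_ext)
  fix n
  have "bij_betw h {x\<in>A. deg x = n} {y\<in>B. deg' y = n}"
    using assms(1,2) unfolding bij_betw_def by (auto simp: inj_on_def)
  from sum.reindex_bij_betw[OF this, of w']
  show "gen_fun B deg' w' $ n = gen_fun A deg w $ n"
    by (auto simp: gen_fun_nth assms(3) intro!: sum.cong)
qed

lemma gen_fun_shift:
  "gen_fun A (\<lambda>x. k + deg x) (\<lambda>x. c * w x) = fps_const c * fps_X ^ k * gen_fun A deg w"
proof (rule fps_ext)
  fix n
  have "{x\<in>A. k + deg x = n} = (if n < k then {} else {x\<in>A. deg x = n - k})" by auto
  then show "gen_fun A (\<lambda>x. k + deg x) (\<lambda>x. c * w x) $ n = (fps_const c * fps_X ^ k * gen_fun A deg w) $ n"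
    by (simp add: gen_fun_nth mult.assoc fps_X_power_mult_nth sum_distrib_left)
qed

lemma finite_fibres_times:
  assumes "finite_fibres A degA" "finite_fibres B degB"
  shows "finite_fibres (A \<times> B) (\<lambda>(x, y). degA x + degB y)"
  unfolding finite_fibres_def
proof
  fix n
  have "{p \<in> A \<times> B. (case p of (x, y) \<Rightarrow> degA x + degB y) = n}
      \<subseteq> (\<Union>i\<le>n. {x\<in>A. degA x = i}) \<times> (\<Union>i\<le>n. {y\<in>B. degB y = i})" by auto
  moreover have "finite \<dots>" using assms by (auto simp: finite_fibres_def)
  ultimately show "finite {p \<in> A \<times> B. (case p of (x, y) \<Rightarrow> degA x + degB y) = n}"
    by (rule finite_subset)
qed

lemma gen_fun_times:
  assumes "finite_fibres A degA" "finite_fibres B degB"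
  shows "gen_fun (A \<times> B) (\<lambda>(x, y). degA x + degB y) (\<lambda>(x, y). v x * w y)
    = gen_fun A degA v * gen_fun B degB w"
proof (rule fps_ext)
  fix n
  let ?A = "\<lambda>i. {x\<in>A. degA x = i}" and ?B = "\<lambda>i. {y\<in>B. degB y = i}"
  have "(gen_fun A degA v * gen_fun B degB w) $ n = (\<Sum>i=0..n. \<Sum>(x, y)\<in>?A i \<times> ?B (n - i). v x * w y)"
    by (simp add: fps_mult_nth gen_fun_nth sum_product sum.cartesian_product)
  also have "\<dots> = (\<Sum>(i, x, y)\<in>(SIGMA i:{0..n}. ?A i \<times> ?B (n - i)). v x * w y)"
    using assms by (subst sum.Sigma) (auto simp: finite_fibres_def)
  also have "\<dots> = (\<Sum>(x, y)\<in>{p \<in> A \<times> B. (case p of (x, y) \<Rightarrow> degA x + degB y) = n}. v x * w y)"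
    by (rule sum.reindex_bij_witness[of _ "\<lambda>(x, y). (degA x, x, y)" "\<lambda>(i, x, y). (x, y)"]) auto
  finally show "gen_fun (A \<times> B) (\<lambda>(x, y). degA x + degB y) (\<lambda>(x, y). v x * w y) $ n
      = (gen_fun A degA v * gen_fun B degB w) $ n"
    by (simp add: gen_fun_nth)
qed

lemma gen_fun_finite:
  assumes "finite A"
  shows "gen_fun A deg w = (\<Sum>x\<in>A. fps_const (w x) * fps_X ^ deg x)"
proof (rule fps_ext)
  fix n
  have "(\<Sum>x\<in>A. (fps_const (w x) * fps_X ^ deg x) $ n) = (\<Sum>x\<in>A. if deg x = n then w x else 0)"
    by (intro sum.cong) (auto simp: fps_X_power_nth)
  also have "\<dots> = (\<Sum>x\<in>{x\<in>A. deg x = n}. w x)"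
    using assms by (simp add: sum.If_cases Int_def)
  finally show "gen_fun A deg w $ n = (\<Sum>x\<in>A. fps_const (w x) * fps_X ^ deg x) $ n"
    by (simp add: gen_fun_nth fps_sum_nth)
qed

text \<open>A set that splits into a base set and a shifted copy of itself yields such an equation.
  Solving it takes the place of a geometric series and avoids division, so the coefficients may lie
  in any commutative ring.\<close>

lemma fixpoint_eq_imp: "a = b + c * a \<Longrightarrow> a * (1 - c) = b" for a b c :: "'a::comm_ring_1"
  unfolding right_diff_distrib mult_1_right diff_eq_eq mult.commute[of a c] .

section \<open>Generating functions of distinct parts, arbitrary parts and multiplicities\<close>

lemma gen_fun_subsets:
  assumes "finite T"
  shows "gen_fun (Pow T) (\<lambda>S. \<Sum>S) (\<lambda>S. x ^ card S) = (\<Prod>t\<in>T. 1 + fps_const x * fps_X ^ t)"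
proof -
  have "(\<Prod>t\<in>T. fps_const x * fps_X ^ t + 1) = (\<Sum>S\<in>Pow T. \<Prod>t\<in>S. fps_const x * fps_X ^ t)"
    using assms by (subst prod_add) auto
  also have "\<dots> = (\<Sum>S\<in>Pow T. fps_const (x ^ card S) * fps_X ^ (\<Sum>S))"
    by (intro sum.cong) (auto simp: prod.distrib power_sum fps_const_power)
  finally show ?thesis using assms by (simp add: gen_fun_finite add.commute)
qed

lemma finite_msets_sum_le: "finite {M. 0 \<notin># M \<and> sum_mset M \<le> (n::nat)}"
proof (induction n)
  case 0
  have "{M. 0 \<notin># M \<and> sum_mset M \<le> (0::nat)} \<subseteq> {{#}}"
    by (auto simp: sum_mset_0_iff)
       (metis multiset_nonemptyE)
  then show ?case using finite_subset by blast
next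
  case (Suc n)
  let ?F = "{M. 0 \<notin># M \<and> sum_mset M \<le> n}"
  have "{M. 0 \<notin># M \<and> sum_mset M \<le> Suc n} \<subseteq> insert {#} (\<Union>t\<in>{..Suc n}. add_mset t ` ?F)"
  proof
    fix M assume M: "M \<in> {M. 0 \<notin># M \<and> sum_mset M \<le> Suc n}"
    show "M \<in> insert {#} (\<Union>t\<in>{..Suc n}. add_mset t ` ?F)"
    proof (cases M)
      case (add t M')
      then have "t > 0" "M' \<in> ?F" "t \<le> Suc n" using M by auto
      then show ?thesis using add by auto
    qed simp
  qed
  then show ?case by (rule finite_subset) (use Suc in simp)
qed

lemma finite_fibres_msets: "0 \<notin> T \<Longrightarrow> finite_fibres {M. set_mset M \<subseteq> T} sum_mset"
  unfolding finite_fibres_def by (auto intro: finite_subset[OF _ finite_msets_sum_le])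

text \<open>A multiset over \<open>insert t T\<close> either avoids t or arises from another such
  multiset by adding one t, so adjoining t to T multiplies the generating function by 1 / (1 - x
  q^t).\<close>

lemma gen_fun_msets:
  fixes x :: "'a::comm_ring_1"
  assumes "finite T" "0 \<notin> T"
  shows "gen_fun {M. set_mset M \<subseteq> T} sum_mset (\<lambda>M. x ^ size M) * (\<Prod>t\<in>T. 1 - fps_const x * fps_X ^ t) = 1"
  using assms
proof (induction T)
  case empty
  have "{M. set_mset M \<subseteq> {}} = {{#} :: nat multiset}" by auto
  then show ?case by (simp add: gen_fun_finite)
next
  case (insert t T)
  let ?H = "\<lambda>T. gen_fun {M. set_mset M \<subseteq> T} sum_mset (\<lambda>M. x ^ size M)"
  let ?I = "{M. set_mset M \<subseteq> insert t T}"
  have un: "?I = {M. set_mset M \<subseteq> T} \<union> add_mset t ` ?I"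
  proof (intro subset_antisym subsetI)
    fix M assume M: "M \<in> ?I"
    show "M \<in> {M. set_mset M \<subseteq> T} \<union> add_mset t ` ?I"
    proof (cases "t \<in># M")
      case True
      then obtain M' where "M = add_mset t M'" by (meson multi_member_split)
      then show ?thesis using M by auto
    qed (use M in auto)
  qed auto
  have ff: "finite_fibres ?I sum_mset" "finite_fibres {M. set_mset M \<subseteq> T} sum_mset"
    using insert.prems by (auto intro!: finite_fibres_msets)
  moreover have "finite_fibres (add_mset t ` ?I) sum_mset"
    by (rule finite_fibres_subset[OF ff(1)]) auto
  moreover have "{M. set_mset M \<subseteq> T} \<inter> add_mset t ` ?I = {}" using insert.hyps by auto
  ultimately have "?H (insert t T) = ?H T + gen_fun (add_mset t ` ?I) sum_mset (\<lambda>M. x ^ size M)"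
    by (subst un) (rule gen_fun_Un_disjoint)
  also have "gen_fun (add_mset t ` ?I) sum_mset (\<lambda>M. x ^ size M)
      = gen_fun ?I (\<lambda>M. t + sum_mset M) (\<lambda>M. x * x ^ size M)"
    by (rule gen_fun_reindex[where h = "add_mset t"]) (auto simp: bij_betw_def inj_on_def)
  also have "\<dots> = fps_const x * fps_X ^ t * ?H (insert t T)"
    by (rule gen_fun_shift)
  finally have "?H (insert t T) * (1 - fps_const x * fps_X ^ t) = ?H T"
    by (rule fixpoint_eq_imp)
  then have "?H (insert t T) * (\<Prod>t\<in>insert t T. 1 - fps_const x * fps_X ^ t)
      = ?H T * (\<Prod>t\<in>T. 1 - fps_const x * fps_X ^ t)"
    using insert.hyps by (simp add: mult.assoc[symmetric])
  then show ?case using insert by simp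
qed

lemma finite_fibres_multiples: "k > 0 \<Longrightarrow> finite_fibres A (\<lambda>j. j * k)" for k :: nat
  unfolding finite_fibres_def
proof
  fix n assume "k > 0"
  then have "{j \<in> A. j * k = n} \<subseteq> {..n}" by auto
  then show "finite {j \<in> A. j * k = n}" using finite_subset by blast
qed

text \<open>Passing from j to j + 1 is a shift by q^k. Weight 1 gives the geometric series; for
  weight j the relation j + 1 = 1 + j brings in the same denominator a second time, hence the
  square. The weight j counts the appearances of a smallest part k of multiplicity j.\<close>

lemma gen_fun_multiples:
  assumes "k > 0"
  shows "gen_fun {1..} (\<lambda>j. j * k) of_nat * (1 - fps_X ^ k)\<^sup>2 = (fps_X ^ k :: 'a::comm_ring_1 fps)"
proof -
  let ?J = "\<lambda>w. gen_fun {1..} (\<lambda>j. j * k) (w :: nat \<Rightarrow> 'a)"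
  have step: "?J w = fps_const (w 1) * fps_X ^ k + fps_X ^ k * ?J (\<lambda>j. w (Suc j))" for w
  proof -
    have "x \<in> {1} \<union> Suc ` {1..}" if "x \<ge> 1" for x
      using that by (cases x) auto
    then have "{1..} = {1} \<union> Suc ` {1..}" by auto
    then have "?J w = gen_fun ({1} \<union> Suc ` {1..}) (\<lambda>j. j * k) w" by simp
    also have "\<dots> = gen_fun {1} (\<lambda>j. j * k) w + gen_fun (Suc ` {1..}) (\<lambda>j. j * k) w"
      by (rule gen_fun_Un_disjoint) (use assms finite_fibres_multiples in auto)
    also have "gen_fun (Suc ` {1..}) (\<lambda>j. j * k) w = gen_fun {1..} (\<lambda>j. k + j * k) (\<lambda>j. 1 * w (Suc j))"
      by (rule gen_fun_reindex[where h = Suc]) (auto simp: bij_betw_def)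
    also have "\<dots> = fps_X ^ k * ?J (\<lambda>j. w (Suc j))"
      unfolding gen_fun_shift by simp
    finally show ?thesis by (simp add: gen_fun_finite)
  qed
  have 1: "?J (\<lambda>_. 1) * (1 - fps_X ^ k) = fps_X ^ k"
    by (rule fixpoint_eq_imp) (use step[of "\<lambda>_. 1"] in simp)
  have 2: "?J of_nat * (1 - fps_X ^ k) = fps_X ^ k + fps_X ^ k * ?J (\<lambda>_. 1)"
    by (rule fixpoint_eq_imp, subst step) (simp add: gen_fun_add distrib_left add.assoc)
  have "?J of_nat * (1 - fps_X ^ k)\<^sup>2 = (?J of_nat * (1 - fps_X ^ k)) * (1 - fps_X ^ k)"
    by (simp add: power2_eq_square mult.assoc)
  also have "\<dots> = fps_X ^ k * (1 - fps_X ^ k) + fps_X ^ k * (?J (\<lambda>_. 1) * (1 - fps_X ^ k))"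
    unfolding 2 by (simp add: distrib_right mult.assoc)
  also have "\<dots> = fps_X ^ k" unfolding 1 by (simp add: algebra_simps)
  finally show ?thesis .
qed

section \<open>Overpartition pairs\<close>

text \<open>The bound N on the parts makes all products finite, and a pair of total size at most N
  satisfies it automatically.\<close>

definition spt_pairs :: "nat \<Rightarrow> nat \<Rightarrow> (overpartition \<times> overpartition) set" where
  "spt_pairs N k = {p. is_overpartition (fst p) \<and> is_overpartition (snd p) \<and> spt_admissible p \<and>
     smallest_part p = k \<and> set_mset (fst (fst p) + fst (snd p)) \<subseteq> {..N}}"

definition pair_size :: "overpartition \<times> overpartition \<Rightarrow> nat" where
  "pair_size p = sum_mset (fst (fst p)) + sum_mset (fst (snd p))"

definition pair_r :: "overpartition \<times> overpartition \<Rightarrow> nat" where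
  "pair_r p = num_overlined (fst p) + num_nonoverlined (snd p)"

definition spt_weight :: "'a::comm_ring_1 \<Rightarrow> 'a \<Rightarrow> overpartition \<times> overpartition \<Rightarrow> 'a" where
  "spt_weight x y p = of_nat (count (fst (fst p)) (smallest_part p)) *
     x ^ pair_r p * y ^ num_parts (snd p)"

type_synonym pair_code = "nat \<times> nat multiset \<times> nat set \<times> nat multiset \<times> nat set"

text \<open>In a code (j, M, S, M', S') the number j is the multiplicity of the smallest part, M and
  M' hold the other non-overlined parts of the two components, and S and S' their overlined parts.
  The five entries are independent, so the generating functions multiply.\<close>

definition pair_codes :: "nat set \<Rightarrow> pair_code set" where
  "pair_codes T = {1..} \<times> {M. set_mset M \<subseteq> T} \<times> Pow T \<times> {M. set_mset M \<subseteq> T} \<times> Pow T"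

text \<open>One copy of each overlined part is split off from the multiset of parts.\<close>

definition decode_pair :: "nat \<Rightarrow> pair_code \<Rightarrow> overpartition \<times> overpartition" where
  "decode_pair k = (\<lambda>(j, M, S, M', S').
     ((replicate_mset j k + (M + mset_set S), S), (M' + mset_set S', S')))"

definition encode_pair :: "nat \<Rightarrow> overpartition \<times> overpartition \<Rightarrow> pair_code" where
  "encode_pair k = (\<lambda>((P, S), (P', S')).
     (count P k, {#x \<in># P. x \<noteq> k#} - mset_set S, S, P' - mset_set S', S'))"

lemma mset_set_subseteq: "S \<subseteq> set_mset M \<Longrightarrow> mset_set S \<subseteq># M"
  by (metis finite_set_mset mset_set_set_mset_msubset subset_imp_msubset_mset_set subset_mset.order_trans)

lemma pair_codes_iff:
  "(j, M, S, M', S') \<in> pair_codes {k<..N} \<longleftrightarrow> j \<ge> 1 \<and> finite S \<and> finite S' \<and>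
     (\<forall>x\<in>#M. k < x \<and> x \<le> N) \<and> (\<forall>x\<in>S. k < x \<and> x \<le> N) \<and>
     (\<forall>x\<in>#M'. k < x \<and> x \<le> N) \<and> (\<forall>x\<in>S'. k < x \<and> x \<le> N)"
  using finite_subset[of S "{k<..N}"] finite_subset[of S' "{k<..N}"]
  by (auto simp: pair_codes_def subset_iff)

lemma smallest_part_decode:
  assumes "c \<in> pair_codes {k<..N}"
  shows "smallest_part (decode_pair k c) = k"
proof -
  obtain j M S M' S' where c: "c = (j, M, S, M', S')" by (cases c)
  show ?thesis using assms unfolding c pair_codes_iff
    by (auto simp: smallest_part_def decode_pair_def less_imp_le intro!: Min_eqI)
qed

text \<open>Every part is at least k, and k itself is neither overlined nor present in the second
  component; apart from the copies of k all parts therefore lie in \<open>{k<..N}\<close>.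
  Positivity of k excludes the part 0.\<close>

lemma bij_betw_decode_pair:
  assumes "0 < k" "k \<le> N"
  shows "bij_betw (decode_pair k) (pair_codes {k<..N}) (spt_pairs N k)"
proof (rule bij_betw_byWitness[where f' = "encode_pair k"]; (intro ballI image_subsetI)?)
  fix c assume c: "c \<in> pair_codes {k<..N}"
  obtain j M S M' S' where c_eq: "c = (j, M, S, M', S')" by (cases c)
  have gt: "\<forall>x\<in>#M. k < x \<and> x \<le> N" "\<forall>x\<in>S. k < x \<and> x \<le> N" and fin: "finite S"
    using c unfolding c_eq pair_codes_iff by auto
  have "count M k = 0" "k \<notin> S" using gt by (auto simp: count_eq_zero_iff)
  moreover have "{#x \<in># M. x \<noteq> k#} = M" "{#x \<in># mset_set S. x \<noteq> k#} = mset_set S"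
    "{#x \<in># replicate_mset j k. x \<noteq> k#} = {#}"
    using filter_mset_cong[of M M "\<lambda>x. x \<noteq> k" "\<lambda>_. True"] gt(1)
      filter_mset_cong[of "mset_set S" "mset_set S" "\<lambda>x. x \<noteq> k" "\<lambda>_. True"] gt(2) fin
    by (fastforce split: if_splits)+
  ultimately show "encode_pair k (decode_pair k c) = c"
    by (simp add: c_eq encode_pair_def decode_pair_def)
next
  fix p assume p: "p \<in> spt_pairs N k"
  obtain P S P' S' where p_eq: "p = ((P, S), (P', S'))" by (metis prod.collapse)
  have P: "0 \<notin># P" "S \<subseteq> set_mset P" "0 \<notin># P'" "S' \<subseteq> set_mset P'" "P + P' \<noteq> {#}"
      "k \<notin> S" "k \<notin># P'" "Min (set_mset (P + P')) = k" "set_mset (P + P') \<subseteq> {..N}"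
    using p by (auto simp: p_eq spt_pairs_def is_overpartition_def spt_admissible_def smallest_part_def)
  have ne: "set_mset (P + P') \<noteq> {}" using P(5) by simp
  have ge: "k \<le> x" if "x \<in># P + P'" for x using Min_le[OF finite_set_mset that] P(8) by simp
  have "k \<in># P + P'" using Min_in[OF finite_set_mset ne] P(8) by simp
  then have kP: "k \<in># P" using P(7) by simp
  have split: "replicate_mset (count P k) k + {#x \<in># P. x \<noteq> k#} = P"
    using multiset_partition[of P "\<lambda>x. x = k"] by (simp add: filter_eq_replicate_mset)
  have S: "mset_set S \<subseteq># {#x \<in># P. x \<noteq> k#}" "mset_set S' \<subseteq># P'"
    using P by (auto intro!: mset_set_subseteq)
  show "decode_pair k (encode_pair k p) = p"
    using split S by (simp add: p_eq encode_pair_def decode_pair_def)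
  have gt: "x \<in> {k<..N}" if "x \<in># P + P'" "x \<noteq> k" for x
  proof -
    have "x \<in> {..N}" using P(9) that(1) by (rule subsetD)
    then show ?thesis using ge[OF that(1)] that(2) by auto
  qed
  have sub: "x \<in> {k<..N}" if "x \<in># {#x \<in># P. x \<noteq> k#} - mset_set S \<or> x \<in># P' - mset_set S' \<or> x \<in> S \<or> x \<in> S'" for x
  proof (rule gt)
    show "x \<in># P + P'" using that P(2,4) by (auto dest: in_diffD)
    show "x \<noteq> k" using that P by (auto dest: in_diffD)
  qed
  have "count P k \<ge> 1" using kP by (simp add: Suc_le_eq)
  then show "encode_pair k p \<in> pair_codes {k<..N}"
    using sub by (simp add: p_eq encode_pair_def pair_codes_def subset_iff)
next
  fix c assume c: "c \<in> pair_codes {k<..N}"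
  obtain j M S M' S' where c_eq: "c = (j, M, S, M', S')" by (cases c)
  show "decode_pair k c \<in> spt_pairs N k"
    using smallest_part_decode[OF c] assms c unfolding c_eq pair_codes_iff
    by (auto simp: spt_pairs_def decode_pair_def is_overpartition_def spt_admissible_def)
qed

lemma gen_fun_spt_pairs:
  fixes x y :: "'a::comm_ring_1"
  assumes k: "0 < k" "k \<le> N"
  shows "gen_fun (spt_pairs N k) pair_size (spt_weight x y) *
      ((1 - fps_X ^ k)\<^sup>2 * (\<Prod>t\<in>{k<..N}. 1 - fps_X ^ t) * (\<Prod>t\<in>{k<..N}. 1 - fps_const (x * y) * fps_X ^ t))
    = fps_X ^ k * (\<Prod>t\<in>{k<..N}. 1 + fps_const x * fps_X ^ t) * (\<Prod>t\<in>{k<..N}. 1 + fps_const y * fps_X ^ t)"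
proof -
  let ?T = "{k<..N}"
  let ?M = "{M. set_mset M \<subseteq> ?T}"
  let ?J = "gen_fun {1..} (\<lambda>j. j * k) (of_nat :: nat \<Rightarrow> 'a)"
  let ?HM = "\<lambda>z :: 'a. gen_fun ?M sum_mset (\<lambda>M. z ^ size M)"
  let ?HS = "\<lambda>z :: 'a. gen_fun (Pow ?T) (\<lambda>S. \<Sum>S) (\<lambda>S. z ^ card S)"
  have ffM: "finite_fibres ?M sum_mset" using k by (intro finite_fibres_msets) auto
  have ffS: "finite_fibres (Pow ?T) (\<lambda>S. \<Sum>S)" by (simp add: finite_fibres_def)
  have ffJ: "finite_fibres {1..} (\<lambda>j. j * k)" using k by (intro finite_fibres_multiples)
  note ff = finite_fibres_times[OF ffM ffS] finite_fibres_times[OF ffS finite_fibres_times[OF ffM ffS]]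
    finite_fibres_times[OF ffM finite_fibres_times[OF ffS finite_fibres_times[OF ffM ffS]]]
  let ?deg = "\<lambda>(j, M, S, M', S'). j * k + (sum_mset M + (\<Sum>S + (sum_mset M' + \<Sum>S')))"
  \<comment> \<open>A non-overlined part of the second component counts for both r and s and gets
    the weight x y, an overlined one counts for s alone. In the first component only overlined parts
    carry an x.\<close>
  let ?w = "\<lambda>(j, M, S, M', S'). of_nat j * (1 ^ size M * (x ^ card S * ((x * y) ^ size M' * y ^ card S')))"
  have "gen_fun (spt_pairs N k) pair_size (spt_weight x y) = gen_fun (pair_codes ?T) ?deg ?w"
  proof (rule gen_fun_reindex[OF bij_betw_decode_pair[OF k]])
    fix c assume c: "c \<in> pair_codes ?T"
    obtain j M S M' S' where c_eq: "c = (j, M, S, M', S')" by (cases c)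
    note cs = c[unfolded c_eq pair_codes_iff]
    have sums: "sum_mset (mset_set A) = \<Sum>A" for A :: "nat set"
      using sum_unfold_sum_mset[of "\<lambda>x. x" A] by simp
    show "pair_size (decode_pair k c) = ?deg c"
      by (simp add: c_eq pair_size_def decode_pair_def sums)
    have "count M k = 0" "k \<notin> S" using cs by (auto simp: count_eq_zero_iff)
    then have "count (fst (fst (decode_pair k c))) (smallest_part (decode_pair k c)) = j"
      unfolding smallest_part_decode[OF c] by (simp add: c_eq decode_pair_def)
    moreover have "pair_r (decode_pair k c) = card S + size M'" "num_parts (snd (decode_pair k c)) = size M' + card S'"
      by (simp_all add: c_eq pair_r_def decode_pair_def num_overlined_def num_nonoverlined_def num_parts_def)
    ultimately show "spt_weight x y (decode_pair k c) = ?w c"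
      by (simp add: spt_weight_def c_eq power_add power_mult_distrib mult_ac)
  qed
  also have "\<dots> = ?J * (?HM 1 * (?HS x * (?HM (x * y) * ?HS y)))"
    unfolding pair_codes_def
    by (subst gen_fun_times[symmetric], (rule ffM ffS ffJ ff)+)+ (simp add: split_def)
  finally have eq: "gen_fun (spt_pairs N k) pair_size (spt_weight x y) = \<dots>" .
  have H1: "?HM 1 * (\<Prod>t\<in>?T. 1 - fps_X ^ t) = 1"
    using gen_fun_msets[of ?T "1::'a"] k by simp
  have H2: "?HM (x * y) * (\<Prod>t\<in>?T. 1 - fps_const (x * y) * fps_X ^ t) = 1"
    using gen_fun_msets[of ?T "x * y"] k by simp
  have rearr: "J * (a * (b * (c * d))) * (J' * a' * c') = (J * J') * b * d" if "a * a' = 1" "c * c' = 1"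
    for J a b c d J' a' c' :: "'a fps"
  proof -
    have "J * (a * (b * (c * d))) * (J' * a' * c') = (J * J') * b * d * (a * a') * (c * c')"
      by (simp add: mult_ac)
    then show ?thesis using that by simp
  qed
  show ?thesis
    unfolding eq rearr[OF H1 H2] gen_fun_multiples[OF k(1)] by (simp add: gen_fun_subsets)
qed

section \<open>Exactness of the truncation up to degree N\<close>

lemma member_le_sum_mset: "x \<in># M \<Longrightarrow> x \<le> sum_mset M" for M :: "nat multiset"
  by (auto dest: multi_member_split)

lemma size_le_sum_mset: "0 \<notin># M \<Longrightarrow> size M \<le> sum_mset M" for M :: "nat multiset"
  by (induction M) auto

lemma finite_overpartition_pairs: "finite (overpartition_pairs n)"
proof -
  let ?F = "{M. 0 \<notin># M \<and> sum_mset M \<le> n}"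
  have "overpartition_pairs n \<subseteq> (?F \<times> Pow {..n}) \<times> (?F \<times> Pow {..n})"
  proof (clarsimp simp: overpartition_pairs_def is_overpartition_def)
    fix M M' :: "nat multiset" and S S'
    assume "S \<subseteq> set_mset M" "S' \<subseteq> set_mset M'"
    moreover have "set_mset M \<subseteq> {..sum_mset M}" "set_mset M' \<subseteq> {..sum_mset M'}"
      using member_le_sum_mset by blast+
    ultimately show "S \<subseteq> {..sum_mset M + sum_mset M'} \<and> S' \<subseteq> {..sum_mset M + sum_mset M'}"
      by fastforce
  qed
  then show ?thesis by (rule finite_subset) (simp add: finite_msets_sum_le)
qed

lemma num_overlined_le: "is_overpartition \<pi> \<Longrightarrow> num_overlined \<pi> \<le> num_parts \<pi>"
  using size_mset_mono[OF mset_set_subseteq[of "snd \<pi>" "fst \<pi>"]]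
  by (simp add: is_overpartition_def num_overlined_def num_parts_def)

text \<open>Parts are positive, so their number is bounded by their sum n. Hence a single cutoff N
  \<ge> n serves for r, s, the parts and the smallest part alike.\<close>

lemma admissible_pair_bounds:
  assumes "p \<in> overpartition_pairs n" "spt_admissible p"
  shows "smallest_part p \<in> {1..n}" "pair_r p \<le> n" "num_parts (snd p) \<le> n" "pair_size p = n"
    "set_mset (fst (fst p) + fst (snd p)) \<subseteq> {..n}"
proof -
  let ?M = "fst (fst p) + fst (snd p)"
  have p: "is_overpartition (fst p)" "is_overpartition (snd p)" "sum_mset (fst (fst p)) + sum_mset (fst (snd p)) = n"
    using assms by (auto simp: overpartition_pairs_def)
  have M: "sum_mset ?M = n" "0 \<notin># ?M" "set_mset ?M \<noteq> {}"
    using p assms(2) by (auto simp: is_overpartition_def spt_admissible_def)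
  have "smallest_part p \<in># ?M"
    unfolding smallest_part_def using M(3) by (rule Min_in[OF finite_set_mset])
  then show "smallest_part p \<in> {1..n}"
    using member_le_sum_mset[of "smallest_part p" ?M] M(1,2) by (cases "smallest_part p") auto
  have "num_parts (fst p) + num_parts (snd p) \<le> n"
    using size_le_sum_mset[OF M(2)] M(1) by (simp add: num_parts_def)
  then show "pair_r p \<le> n" "num_parts (snd p) \<le> n"
    using num_overlined_le[OF p(1)] by (auto simp: pair_r_def num_nonoverlined_def)
  show "pair_size p = n" using p(3) by (simp add: pair_size_def)
  show "set_mset ?M \<subseteq> {..n}" using member_le_sum_mset[of _ ?M] M(1) by auto
qed

text \<open>The admissible pairs of n are grouped once by (r, s) and once by their smallest part;
  since n \<le> N, neither grouping misses a pair.\<close>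

lemma sum_spt_eq_gen_fun_nth:
  fixes x y :: "'a::comm_ring_1"
  assumes "n \<le> N"
  shows "(\<Sum>r\<le>N. \<Sum>s\<le>N. of_nat (spt r s n) * x ^ r * y ^ s)
    = (\<Sum>k=1..N. gen_fun (spt_pairs N k) pair_size (spt_weight x y)) $ n"
proof -
  define P where "P = {p \<in> overpartition_pairs n. spt_admissible p}"
  have fin: "finite P" using finite_overpartition_pairs by (simp add: P_def)
  note bounds = admissible_pair_bounds[of _ n]
  let ?rs = "\<lambda>p. (pair_r p, num_parts (snd p))"
  have "of_nat (spt r s n) * x ^ r * y ^ s = (\<Sum>p\<in>{p\<in>P. ?rs p = (r, s)}. spt_weight x y p)" for r s
  proof -
    have "spt r s n = (\<Sum>p\<in>{p\<in>P. ?rs p = (r, s)}. count (fst (fst p)) (smallest_part p))"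
      unfolding spt_def by (intro sum.cong) (auto simp: P_def pair_r_def)
    then show ?thesis by (auto simp: spt_weight_def sum_distrib_right intro!: sum.cong)
  qed
  then have "(\<Sum>r\<le>N. \<Sum>s\<le>N. of_nat (spt r s n) * x ^ r * y ^ s)
      = (\<Sum>(r, s)\<in>{..N} \<times> {..N}. \<Sum>p\<in>{p\<in>P. ?rs p = (r, s)}. spt_weight x y p)"
    by (simp add: sum.cartesian_product)
  also have "\<dots> = (\<Sum>rs\<in>{..N} \<times> {..N}. \<Sum>p\<in>{p\<in>P. ?rs p = rs}. spt_weight x y p)"
    by (intro sum.cong) auto
  also have "\<dots> = (\<Sum>p\<in>P. spt_weight x y p)"
  proof (intro sum.group fin image_subsetI)
    fix p assume "p \<in> P"
    then show "?rs p \<in> {..N} \<times> {..N}" using bounds(2,3)[of p] assms by (simp add: P_def)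
  qed simp
  also have "\<dots> = (\<Sum>k\<in>{1..N}. \<Sum>p\<in>{p\<in>P. smallest_part p = k}. spt_weight x y p)"
  proof (intro sum.group[symmetric] fin image_subsetI)
    fix p assume "p \<in> P"
    then show "smallest_part p \<in> {1..N}" using bounds(1)[of p] assms by (simp add: P_def)
  qed simp
  also have "\<dots> = (\<Sum>k=1..N. \<Sum>p\<in>{p\<in>spt_pairs N k. pair_size p = n}. spt_weight x y p)"
  proof (intro sum.cong refl arg_cong2[of _ _ _ _ sum])
    fix k
    show "{p\<in>P. smallest_part p = k} = {p\<in>spt_pairs N k. pair_size p = n}"
    proof (intro set_eqI iffI)
      fix p assume "p \<in> {p\<in>P. smallest_part p = k}"
      then have p: "p \<in> overpartition_pairs n" "spt_admissible p" "smallest_part p = k" by (auto simp: P_def)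
      have "set_mset (fst (fst p) + fst (snd p)) \<subseteq> {..N}"
        using bounds(5)[OF p(1,2)] by (rule order_trans) (use assms in auto)
      then show "p \<in> {p\<in>spt_pairs N k. pair_size p = n}"
        using p bounds(4)[OF p(1,2)] by (auto simp: spt_pairs_def overpartition_pairs_def)
    qed (auto simp: P_def spt_pairs_def overpartition_pairs_def pair_size_def)
  qed
  finally show ?thesis by (simp add: fps_sum_nth gen_fun_nth)
qed

section \<open>Passage to the limit\<close>

declare fls_X_power_int [simp del]

section \<open>Finite q-products, their reflections and finite geometric remainders\<close>

lemma qfact_eq_qprod: "qfact q = qprod q (- 1)"
  by (simp add: fun_eq_iff qfact_def qprod_def)

lemma qprod_split: "k \<le> N \<Longrightarrow> qprod q d N = qprod q d k * (\<Prod>t\<in>{k<..N}. 1 + d * q ^ t)"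
proof (induction N rule: dec_induct)
  case (step n)
  have "{k<..Suc n} = insert (Suc n) {k<..n}" using step.hyps by auto
  then show ?case using step by (simp add: qprod_Suc mult_ac del: power_Suc)
qed simp

text \<open>Each factor absorbs one d, as d (1 + q^t / d) = d + q^t; this clears the denominators of
  (-1/d)_m.\<close>

lemma qshift_eq_scaled_prod:
  fixes q d :: "'a::field"
  assumes "d \<noteq> 0"
  shows "d ^ m * (\<Prod>t<m. 1 - - (1 / d) * q ^ t) = qshift q d m"
  using assms by (induction m) (simp_all add: qshift_Suc field_simps)

text \<open>The product over t is the reciprocal of (-1/d)_(-m). Multiplying its factor t by d
  q^(m-t) gives 1 + d q^(m-t), and the exponents m - t run from m down to 1, with sum m (m + 1) /
  2.\<close>

lemma qprod_eq_scaled_powi_prod: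
  fixes q d :: "'a::field"
  assumes "d \<noteq> 0" "q \<noteq> 0"
  shows "q ^ (\<Sum>{..m}) * (d ^ m * (\<Prod>t<m. 1 - - (1 / d) * q powi (- int m) * q ^ t)) = qprod q d m"
proof -
  have "q ^ (\<Sum>{..m}) = (\<Prod>k<m. q ^ Suc k)"
    by (induction m) (simp_all add: power_add mult_ac)
  also have "\<dots> = (\<Prod>t<m. q ^ Suc (m - Suc t))"
    by (rule prod.nat_diff_reindex[symmetric])
  finally have 1: "q ^ (\<Sum>{..m}) = (\<Prod>t<m. q ^ Suc (m - Suc t))" .
  have 2: "d ^ m = (\<Prod>t<m. d)" by simp
  have "qprod q d m = (\<Prod>t<m. 1 + d * q ^ Suc (m - Suc t))"
    unfolding qprod_def by (rule prod.nat_diff_reindex[symmetric])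
  also have "\<dots> = (\<Prod>t<m. q ^ Suc (m - Suc t) * (d * (1 - - (1 / d) * q powi (- int m) * q ^ t)))"
  proof (rule prod.cong[OF refl])
    fix t assume "t \<in> {..<m}"
    then have "q ^ m = q ^ Suc (m - Suc t) * q ^ t" by (simp flip: power_add power_Suc)
    then have "q ^ Suc (m - Suc t) * (q powi (- int m) * q ^ t) = 1"
      using assms by (simp add: power_int_minus field_simps)
    then show "1 + d * q ^ Suc (m - Suc t) = q ^ Suc (m - Suc t) * (d * (1 - - (1 / d) * q powi (- int m) * q ^ t))"
      using assms(1) by (simp add: algebra_simps)
  qed
  finally show ?thesis unfolding 1 2 by (simp add: prod.distrib)
qed

text \<open>Counterpart for the reciprocal of (-dq)_(-m): multiplying factor t by q^(m-1-t) gives d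
  + q^(m-1-t). A negative index thus exchanges the roles of the two kinds of symbols.\<close>

lemma qshift_eq_powi_prod:
  fixes q d :: "'a::field"
  assumes "q \<noteq> 0"
  shows "q ^ (\<Sum>{..<m}) * (\<Prod>t<m. 1 - - d * q * q powi (- int m) * q ^ t) = qshift q d m"
proof -
  have "q ^ (\<Sum>{..<m}) = (\<Prod>k<m. q ^ k)"
    by (induction m) (simp_all add: power_add mult_ac)
  also have "\<dots> = (\<Prod>t<m. q ^ (m - Suc t))"
    by (rule prod.nat_diff_reindex[symmetric])
  finally have 1: "q ^ (\<Sum>{..<m}) = (\<Prod>t<m. q ^ (m - Suc t))" .
  have "qshift q d m = (\<Prod>t<m. d + q ^ (m - Suc t))"
    unfolding qshift_def by (rule prod.nat_diff_reindex[symmetric])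
  also have "\<dots> = (\<Prod>t<m. q ^ (m - Suc t) * (1 - - d * q * q powi (- int m) * q ^ t))"
  proof (rule prod.cong[OF refl])
    fix t assume "t \<in> {..<m}"
    then have "q ^ m = q ^ Suc (m - Suc t) * q ^ t" by (simp flip: power_add power_Suc)
    then have "q ^ (m - Suc t) * (q * q powi (- int m) * q ^ t) = 1"
      using assms by (simp add: power_int_minus field_simps)
    then show "d + q ^ (m - Suc t) = q ^ (m - Suc t) * (1 - - d * q * q powi (- int m) * q ^ t)"
      by (simp add: algebra_simps)
  qed
  finally show ?thesis unfolding 1 by (simp add: prod.distrib)
qed

text \<open>The exact remainder exhibits the factor x^(N+1), so at x = q^n the truncated series is
  correct to order n (N + 1).\<close>

lemma sum_multiples_powers:
  fixes x :: "'a::field"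
  assumes "x \<noteq> 1"
  shows "x / (1 - x)\<^sup>2 - (\<Sum>m=1..N. of_nat m * x ^ m)
    = x * x ^ N * (of_nat (Suc N) - of_nat N * x) / (1 - x)\<^sup>2"
proof -
  have nz: "1 - x \<noteq> 0" using assms by simp
  have "x - (\<Sum>m=1..N. of_nat m * x ^ m) * (1 - x)\<^sup>2 = x * x ^ N * (of_nat (Suc N) - of_nat N * x)"
  proof (induction N)
    case (Suc N)
    have "x - (\<Sum>m=1..Suc N. of_nat m * x ^ m) * (1 - x)\<^sup>2
       = x * x ^ N * (of_nat (Suc N) - of_nat N * x) - of_nat (Suc N) * x ^ Suc N * (1 - x)\<^sup>2"
      using Suc.IH by (simp add: distrib_right algebra_simps)
    also have "\<dots> = x * x ^ Suc N * (of_nat (Suc (Suc N)) - of_nat (Suc N) * x)"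
      by (simp add: power2_eq_square algebra_simps)
    finally show ?case .
  qed simp
  then show ?thesis using nz by (simp add: field_simps)
qed

lemma sum_powers_multiple:
  fixes x c :: "'a::field"
  assumes "x \<noteq> 1"
  shows "c * x / (1 - x) - (\<Sum>m=1..N. c * x ^ m) = c * x * x ^ N / (1 - x)"
proof -
  have nz: "1 - x \<noteq> 0" using assms by simp
  have "c * x - (\<Sum>m=1..N. c * x ^ m) * (1 - x) = c * x * x ^ N"
    by (induction N) (simp_all add: distrib_right algebra_simps)
  then show ?thesis using nz by (simp add: field_simps)
qed

text \<open>A series 1 + O(q^m) with m >= 1 is a unit among the power series, and 1 / f - 1 = (1 -
  f) / f is again O(q^m).\<close>

lemma fls_vanish_one_minus:
  fixes f :: "'a::field fls"
  assumes "fls_vanish m (f - 1)" "m \<ge> 1"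
  shows "f \<noteq> 0" "fls_vanish 0 f" "fls_vanish m (inverse f - 1)" "fls_vanish 0 (inverse f)"
proof -
  have "f $$ 0 = 1" using fls_vanishD[OF assms(1), of 0] assms(2) by simp
  then show nz: "f \<noteq> 0" by auto
  show "fls_vanish 0 f" using fls_vanish_add[OF fls_vanish_mono[OF assms(1), of 0] fls_vanish_1] assms(2) by simp
  then have "fls_subdegree f = 0"
    using \<open>f $$ 0 = 1\<close> by (intro fls_subdegree_eqI) (auto dest: fls_vanishD)
  then show inv: "fls_vanish 0 (inverse f)" by (simp add: fls_vanish_iff)
  have "inverse f - 1 = (1 - f) * inverse f" using nz by (simp add: field_simps)
  moreover have "fls_vanish m (1 - f)" using assms(1) fls_vanish_diff_commute by blast
  ultimately show "fls_vanish m (inverse f - 1)" using inv by (simp add: fls_vanish_mult_right)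
qed

lemma fls_vanish_const_X_power: "fls_vanish (int n) (fls_const c * fls_X ^ n)"
  for c :: "'a::comm_ring_1"
  by (intro fls_vanish_mult_left) (auto simp: fls_vanish_X_power)

lemma qprod_fls_unit:
  fixes c :: "'a::field"
  shows "fls_vanish 1 (qprod fls_X (fls_const c) n - 1)"
  unfolding qprod_def
  using fls_vanish_mono[OF fls_vanish_const_X_power[of "Suc _" c]]
  by (intro fls_vanish_prod_minus_1) (auto simp del: power_Suc)

lemma qprod_fls_ratio:
  fixes c :: "'a::field"
  assumes "k \<le> N"
  shows "fls_vanish (int k + 1) (qprod fls_X (fls_const c) N / qprod fls_X (fls_const c) k - 1)"
proof -
  have "qprod fls_X (fls_const c) k \<noteq> 0" using fls_vanish_one_minus(1)[OF qprod_fls_unit] by simp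
  then have "qprod fls_X (fls_const c) N / qprod fls_X (fls_const c) k = (\<Prod>t\<in>{k<..N}. 1 + fls_const c * fls_X ^ t)"
    using qprod_split[OF assms, of fls_X "fls_const c"] by simp
  also have "fls_vanish (int k + 1) (\<dots> - 1)"
  proof (rule fls_vanish_prod_minus_1)
    fix t assume "t \<in> {k<..N}"
    then show "fls_vanish (int k + 1) (1 + fls_const c * fls_X ^ t - 1)"
      using fls_vanish_mono[OF fls_vanish_const_X_power[of t c], of "int k + 1"] by simp
  qed simp
  finally show ?thesis .
qed

section \<open>The multiple symbol at integer index\<close>

lemma qpoch_factor_vanish:
  fixes as :: "'a::field fls list"
  shows "\<exists>n. \<forall>t\<ge>n. fls_vanish (int t - int n + 1) ((\<Prod>a\<leftarrow>as. 1 - a * fls_X ^ t) - 1)"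
proof (induction as)
  case (Cons a as)
  then obtain n where n: "\<And>t. t \<ge> n \<Longrightarrow> fls_vanish (int t - int n + 1) ((\<Prod>a\<leftarrow>as. 1 - a * fls_X ^ t) - 1)"
    by blast
  \<comment> \<open>For t at least 1 minus the subdegree of a, the term a q^t has positive order
    despite a possible pole of a. Such poles come from the negative powers of q in shifted
    arguments.\<close>
  define k where "k = max n (nat (1 - fls_subdegree a))"
  have "fls_vanish (int t - int k + 1) ((\<Prod>a\<leftarrow>a # as. 1 - a * fls_X ^ t) - 1)" if t: "t \<ge> k" for t
  proof -
    let ?m = "int t - int k + 1"
    have "fls_vanish (fls_subdegree a + int t) (a * fls_X ^ t)"
      by (intro fls_vanish_mult) (auto simp: fls_vanish_iff)
    then have "fls_vanish ?m (a * fls_X ^ t)" by (rule fls_vanish_mono) (simp add: k_def)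
    then have 1: "fls_vanish ?m (1 - a * fls_X ^ t - 1)" by (simp add: fls_vanish_minus_iff)
    moreover have "fls_vanish ?m ((\<Prod>a\<leftarrow>as. 1 - a * fls_X ^ t) - 1)"
      using t by (intro fls_vanish_mono[OF n]) (auto simp: k_def)
    moreover have "fls_vanish 0 (1 - a * fls_X ^ t)"
      using t by (intro fls_vanish_one_minus(2)[OF 1]) simp
    ultimately show ?thesis
      using fls_vanish_mult_cong[of ?m "1 - a * fls_X ^ t" 1 "\<Prod>a\<leftarrow>as. 1 - a * fls_X ^ t" 1] by simp
  qed
  then show ?case by blast
qed simp

text \<open>A vanishing factor would make the infinite product 0 and division by it meaningless; the
  hypothesis excludes this, and all but finitely many factors are 1 modulo q.\<close>

lemma qpoch_inf_limit:
  fixes as :: "'a::field fls list"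
  assumes "\<And>a t. a \<in> set as \<Longrightarrow> a * fls_X ^ t \<noteq> 1"
  shows "(\<lambda>N. \<Prod>t<N. \<Prod>a\<leftarrow>as. 1 - a * fls_X ^ t) \<longlonglongrightarrow> qpoch_inf as" "qpoch_inf as \<noteq> 0"
proof -
  let ?f = "\<lambda>t. \<Prod>a\<leftarrow>as. 1 - a * fls_X ^ t"
  obtain n where n: "\<And>t. t \<ge> n \<Longrightarrow> fls_vanish (int t - int n + 1) (?f t - 1)"
    using qpoch_factor_vanish[of as] by blast
  have "?f t \<noteq> 0" for t using assms by (auto simp: prod_list_zero_iff)
  moreover have "fls_vanish (int t + 1) (?f (t + n) - 1)" for t using n[of "t + n"] by simp
  ultimately obtain L where "(\<lambda>N. \<Prod>t<N. ?f t) \<longlonglongrightarrow> L" "L \<noteq> 0" "?f has_prod L"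
    using has_prod_flsI[of ?f n] by metis
  moreover from this have "qpoch_inf as = L" by (simp add: qpoch_inf_def has_prod_unique[symmetric])
  ultimately show "(\<lambda>N. \<Prod>t<N. ?f t) \<longlonglongrightarrow> qpoch_inf as" "qpoch_inf as \<noteq> 0" by auto
qed

lemma qpoch_inf_shift:
  fixes as :: "'a::field fls list"
  assumes "\<And>a t. a \<in> set as \<Longrightarrow> a * fls_X ^ t \<noteq> 1"
  shows "qpoch_inf as = (\<Prod>t<n. \<Prod>a\<leftarrow>as. 1 - a * fls_X ^ t) * qpoch_inf (map (\<lambda>a. a * fls_X ^ n) as)"
proof -
  let ?f = "\<lambda>t. \<Prod>a\<leftarrow>as. 1 - a * fls_X ^ t"
  let ?g = "\<lambda>t. \<Prod>a\<leftarrow>map (\<lambda>a. a * fls_X ^ n) as. 1 - a * fls_X ^ t"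
  have "(\<lambda>N. \<Prod>t<N. ?g t) \<longlonglongrightarrow> qpoch_inf (map (\<lambda>a. a * fls_X ^ n) as)"
    using assms by (intro qpoch_inf_limit) (auto simp: mult.assoc simp flip: power_add)
  then have "(\<lambda>N. (\<Prod>t<n. ?f t) * (\<Prod>t<N. ?g t)) \<longlonglongrightarrow> (\<Prod>t<n. ?f t) * qpoch_inf (map (\<lambda>a. a * fls_X ^ n) as)"
    by (intro tendsto_mult tendsto_const)
  moreover have g: "?g t = ?f (t + n)" for t
    by (simp add: o_def power_add mult_ac)
  have "(\<Prod>t<n. ?f t) * (\<Prod>t<N. ?g t) = (\<Prod>t<N + n. ?f t)" for N
    unfolding g by (induction N) (simp_all add: mult.assoc)
  ultimately have "(\<lambda>N. \<Prod>t<N + n. ?f t) \<longlonglongrightarrow> (\<Prod>t<n. ?f t) * qpoch_inf (map (\<lambda>a. a * fls_X ^ n) as)"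
    by simp
  moreover have "(\<lambda>N. \<Prod>t<N + n. ?f t) \<longlonglongrightarrow> qpoch_inf as"
    using qpoch_inf_limit(1)[OF assms] by (rule LIMSEQ_ignore_initial_segment)
  ultimately show ?thesis by (rule LIMSEQ_unique[symmetric])
qed

lemma qpoch_of_nat:
  fixes as :: "'a::field fls list"
  assumes "\<And>a t. a \<in> set as \<Longrightarrow> a * fls_X ^ t \<noteq> 1"
  shows "qpoch as (int n) = (\<Prod>t<n. \<Prod>a\<leftarrow>as. 1 - a * fls_X ^ t)"
proof -
  have "qpoch_inf (map (\<lambda>a. a * fls_X ^ n) as) \<noteq> 0"
    using assms by (intro qpoch_inf_limit(2)) (auto simp: mult.assoc simp flip: power_add)
  then show ?thesis
    using qpoch_inf_shift[OF assms, where n = n] by (simp add: qpoch_def power_int_of_nat)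
qed

text \<open>Shifting the arguments a q^(-n) by n steps leads back to a, so the quotient in
  \<open>qpoch\<close> reduces to the n factors in between, now in the denominator.\<close>

lemma qpoch_minus_of_nat:
  fixes as :: "'a::field fls list"
  assumes "\<And>a i. a \<in> set as \<Longrightarrow> a * fls_X powi i \<noteq> 1"
  shows "qpoch as (- int n) = 1 / (\<Prod>t<n. \<Prod>a\<leftarrow>as. 1 - a * fls_X powi (- int n) * fls_X ^ t)"
proof -
  let ?bs = "map (\<lambda>a. a * fls_X powi (- int n)) as"
  have X: "fls_X powi (- int n) * fls_X ^ t = (fls_X powi (int t - int n) :: 'a fls)" for t
    using power_int_add[of "fls_X :: 'a fls" "- int n" "int t", symmetric] by (simp add: power_int_of_nat)
  have "qpoch_inf ?bs = (\<Prod>t<n. \<Prod>b\<leftarrow>?bs. 1 - b * fls_X ^ t) * qpoch_inf (map (\<lambda>b. b * fls_X ^ n) ?bs)"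
    using assms by (intro qpoch_inf_shift) (auto simp: mult.assoc X)
  also have "map (\<lambda>b. b * fls_X ^ n) ?bs = as" by (simp add: o_def mult.assoc X)
  finally have "qpoch_inf ?bs = (\<Prod>t<n. \<Prod>a\<leftarrow>as. 1 - a * fls_X powi (- int n) * fls_X ^ t) * qpoch_inf as"
    by (simp add: o_def)
  moreover have "qpoch_inf as \<noteq> 0"
    using assms[of _ "int _"] by (intro qpoch_inf_limit(2)) (auto simp: power_int_of_nat)
  ultimately show ?thesis by (simp add: qpoch_def)
qed

lemma fls_const_X_powi_neq_1:
  fixes c :: "'a::field"
  assumes "c \<noteq> 1"
  shows "fls_const c * fls_X powi i \<noteq> 1"
proof
  assume eq: "fls_const c * fls_X powi i = 1"
  then have "fls_const c \<noteq> 0" by auto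
  then have "fls_subdegree (fls_const c * fls_X powi i) = i" by simp
  then have "i = 0" using eq by simp
  then show False using eq assms by simp
qed

definition euler_quotient :: "'a::field \<Rightarrow> 'a \<Rightarrow> 'a \<Rightarrow> nat \<Rightarrow> 'a" where
  "euler_quotient q d e N = qprod q d N * qprod q e N / (qfact q N * qprod q (- (d * e)) N)"

definition lambert_sum :: "'a::field \<Rightarrow> nat \<Rightarrow> 'a" where
  "lambert_sum q N = (\<Sum>n=1..N. of_nat n * q ^ n / (1 - q ^ n))"

definition bailey_sum :: "'a::field \<Rightarrow> 'a \<Rightarrow> 'a \<Rightarrow> nat \<Rightarrow> 'a" where
  "bailey_sum q d e N = (\<Sum>r=1..N. bailey_alpha q d e r * (q ^ r / (1 - q ^ r)\<^sup>2))"

text \<open>What alpha_r for r > 0 and the summands r and -r of the bilateral sum share: up to sign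
  they differ from it only by functions of q that do not involve d and e.\<close>

definition bailey_core :: "'a::field \<Rightarrow> 'a \<Rightarrow> 'a \<Rightarrow> nat \<Rightarrow> 'a" where
  "bailey_core q d e r = (- 1) ^ r * (qshift q d r * qshift q e r) / (qprod q d r * qprod q e r)"

lemma fps_to_fls_prod: "fps_to_fls (prod f A) = (\<Prod>x\<in>A. fps_to_fls (f x))"
  for f :: "'b \<Rightarrow> 'a::comm_ring_1 fps"
  by (induction A rule: infinite_finite_induct) (simp_all add: fls_times_fps_to_fls)

lemma fps_to_fls_sum: "fps_to_fls (sum f A) = (\<Sum>x\<in>A. fps_to_fls (f x))"
  for f :: "'b \<Rightarrow> 'a::comm_ring_1 fps"
  by (induction A rule: infinite_finite_induct) simp_all

lemma fls_X_power_neq_1: "n > 0 \<Longrightarrow> (fls_X ^ n :: 'a::field fls) \<noteq> 1"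
proof
  assume "n > 0" and eq: "fls_X ^ n = (1 :: 'a fls)"
  then have "(fls_X ^ n :: 'a fls) $$ 0 = 0" by (subst fls_X_power_nth) simp
  then show False unfolding eq by simp
qed

lemma one_plus_const_X_power_nonzero: "n > 0 \<Longrightarrow> 1 + fls_const c * fls_X ^ n \<noteq> 0"
  for c :: "'a::field"
  using fls_vanish_mono[OF fls_vanish_const_X_power[of n c], of 1]
  by (intro fls_vanish_one_minus(1)[of 1]) auto

lemma fls_vanish_divide_one_minus_power:
  fixes f :: "'a::field fls"
  assumes "fls_vanish m f" "n > 0"
  shows "fls_vanish m (f / (1 - fls_X ^ n) ^ k)"
proof -
  have "fls_vanish 1 (1 - fls_X ^ n - 1 :: 'a fls)"
    using assms(2) by (simp add: fls_vanish_minus_iff fls_vanish_X_power)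
  from fls_vanish_one_minus(4)[OF this] have "fls_vanish 0 (inverse (1 - fls_X ^ n) ^ k :: 'a fls)"
    using fls_vanish_prod[of "{..<k}" "\<lambda>_. inverse (1 - fls_X ^ n) :: 'a fls"] by simp
  then have "fls_vanish m (f * inverse (1 - fls_X ^ n) ^ k)" using assms(1) by (intro fls_vanish_mult_right)
  then show ?thesis by (simp add: field_simps)
qed

section \<open>Error terms of the truncated identity\<close>

context
  fixes a b :: "'a::field" and q d e :: "'a fls"
  defines "q \<equiv> fls_X" and "d \<equiv> fls_const a" and "e \<equiv> fls_const b"
begin

lemma qprod_nz: "qprod q d n \<noteq> 0" "qprod q e n \<noteq> 0" "qfact q n \<noteq> 0" "qprod q (- (d * e)) n \<noteq> 0"
  using fls_vanish_one_minus(1)[OF qprod_fls_unit[of a n]] fls_vanish_one_minus(1)[OF qprod_fls_unit[of b n]]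
    fls_vanish_one_minus(1)[OF qprod_fls_unit[of "-1" n]] fls_vanish_one_minus(1)[OF qprod_fls_unit[of "- (a * b)" n]]
  by (simp_all add: q_def d_def e_def qfact_eq_qprod)

text \<open>The tail products over k < t \<le> N are quotients of symbols at N by symbols at k, and
  the symbols at N form the prefactor common to all k. What remains contains (q)_k / (1 - q^k)^2 =
  (q)_(k-1)^2 / (q)_k, which gives (q)_(k-1)^2 q^k beta_k.\<close>

lemma gen_fun_spt_total:
  "fps_to_fls (\<Sum>k=1..N. gen_fun (spt_pairs N k) pair_size (spt_weight a b))
   = euler_quotient q d e N * (\<Sum>n=1..N. qfact q (n - 1) ^ 2 * q ^ n * (qprod q (- (d * e)) n / (qfact q n * qprod q d n * qprod q e n)))"
  unfolding fps_to_fls_sum sum_distrib_left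
proof (intro sum.cong refl)
  fix k assume k: "k \<in> {1..N}"
  let ?T = "{k<..N}"
  define P where "P c = (\<Prod>t\<in>?T. 1 + c * q ^ t)" for c
  define F where "F = fps_to_fls (gen_fun (spt_pairs N k) pair_size (spt_weight a b))"
  have split: "qprod q c N = qprod q c k * P c" for c
    using k by (simp add: P_def qprod_split)
  have nz: "P d \<noteq> 0" "P e \<noteq> 0" "P (-1) \<noteq> 0" "P (- (d * e)) \<noteq> 0"
    using qprod_nz[of N] unfolding qfact_eq_qprod split by auto
  have "1 - q ^ k \<noteq> 0" using fls_X_power_neq_1[of k] k by (simp add: q_def)
  have const: "fps_to_fls (\<Prod>t\<in>?T. 1 + fps_const x * fps_X ^ t) = P (fls_const x)" for x
    by (simp add: P_def q_def fps_to_fls_prod fls_times_fps_to_fls fps_to_fls_power)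
  have "F * ((1 - q ^ k)\<^sup>2 * P (-1) * P (- (d * e))) = q ^ k * P d * P e"
  proof -
    have 1: "(\<Prod>t\<in>?T. 1 - fps_X ^ t) = (\<Prod>t\<in>?T. 1 + fps_const (-1 :: 'a) * fps_X ^ t)"
      "(\<Prod>t\<in>?T. 1 - fps_const (a * b) * fps_X ^ t) = (\<Prod>t\<in>?T. 1 + fps_const (- (a * b)) * fps_X ^ t)"
      by (simp_all flip: fps_const_neg)
    have "fps_to_fls ((1 - fps_X ^ k :: 'a fps)\<^sup>2) = (1 - q ^ k)\<^sup>2"
      by (simp add: fps_to_fls_power q_def)
    then show ?thesis
      using arg_cong[OF gen_fun_spt_pairs[of k N a b], of fps_to_fls] k
      unfolding 1 fls_times_fps_to_fls const F_def[symmetric]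
      by (simp add: fps_to_fls_power q_def d_def e_def flip: fls_const_mult_const)
  qed
  then have "F = q ^ k * P d * P e / ((1 - q ^ k)\<^sup>2 * P (-1) * P (- (d * e)))"
    using nz \<open>1 - q ^ k \<noteq> 0\<close> by (simp add: field_simps)
  moreover have "qfact q k = qfact q (k - 1) * (1 - q ^ k)"
    using k qfact_Suc[of q "k - 1"] by simp
  ultimately show "F = euler_quotient q d e N * (qfact q (k - 1) ^ 2 * q ^ k * (qprod q (- (d * e)) k / (qfact q k * qprod q d k * qprod q e k)))"
    using nz \<open>1 - q ^ k \<noteq> 0\<close> qprod_nz[of k] qprod_nz[of "k - 1"]
    unfolding euler_quotient_def split qfact_eq_qprod
    by (simp add: power2_eq_square mult_ac)
qed

lemma bailey_core_vanish: "fls_vanish 0 (bailey_core q d e r)"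
proof -
  have "fls_vanish 0 ((- 1 :: 'a fls) ^ r)" by (cases "even r") (auto simp: fls_vanish_minus_iff)
  moreover have "fls_vanish 0 (qshift q c r)" if "fls_vanish 0 c" for c
    unfolding qshift_def using that by (intro fls_vanish_prod fls_vanish_add) (auto simp: q_def fls_vanish_X_power)
  moreover have "fls_vanish 0 (inverse (qprod q d r))" "fls_vanish 0 (inverse (qprod q e r))"
    using fls_vanish_one_minus(4)[OF qprod_fls_unit] by (simp_all add: q_def d_def e_def)
  ultimately have "fls_vanish 0 ((- 1) ^ r * (qshift q d r * qshift q e r) *
       (inverse (qprod q d r) * inverse (qprod q e r)))"
    by (intro fls_vanish_mult_left[of 0]) (simp_all add: d_def e_def)
  then show ?thesis by (simp add: bailey_core_def field_simps)
qed

lemma bailey_alpha_vanish: "fls_vanish 0 (bailey_alpha q d e r)"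
proof (cases "r = 0")
  case False
  have X: "fls_vanish 0 (q ^ n)" for n by (simp add: q_def fls_vanish_X_power)
  have "fls_vanish 0 (bailey_core q d e r * (q ^ (\<Sum>{..r}) * (1 + q ^ r)))"
    by (intro fls_vanish_mult_left[of 0] fls_vanish_add bailey_core_vanish X fls_vanish_1)
  then show ?thesis using False by (simp add: bailey_alpha_def bailey_core_def mult_ac)
qed (simp add: bailey_alpha_def)

text \<open>Both sums come from the double series of m q^(m n), summed over m first or over n first.
  The square m, n \<le> N is symmetric, so only the remainders of the inner series are left, each
  divisible by q^(n (N + 1)).\<close>

lemma lambert_sum_cong: "fls_vanish (int N) ((\<Sum>n=1..N. q ^ n / (1 - q ^ n)\<^sup>2) - lambert_sum q N)"
proof -
  have "(\<Sum>n=1..N. \<Sum>m=1..N. of_nat m * (q ^ n) ^ m) = (\<Sum>m=1..N. \<Sum>n=1..N. of_nat m * (q ^ m) ^ n)"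
    by (subst sum.swap) (simp add: mult.commute flip: power_mult)
  then have "(\<Sum>n=1..N. q ^ n / (1 - q ^ n)\<^sup>2) - lambert_sum q N
    = (\<Sum>n=1..N. q ^ n / (1 - q ^ n)\<^sup>2 - (\<Sum>m=1..N. of_nat m * (q ^ n) ^ m))
      - (\<Sum>n=1..N. of_nat n * q ^ n / (1 - q ^ n) - (\<Sum>m=1..N. of_nat n * (q ^ n) ^ m))"
    by (simp add: lambert_sum_def sum_subtractf)
  also have "fls_vanish (int N) \<dots>"
  proof (rule fls_vanish_diff; rule fls_vanish_sum)
    fix n assume n: "n \<in> {1..N}"
    then have n1: "q ^ n \<noteq> 1" by (simp add: q_def fls_X_power_neq_1)
    have v: "fls_vanish (int N) (q ^ n * (q ^ n) ^ N)"
    proof (rule fls_vanish_mono)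
      show "fls_vanish (int (n + n * N)) (q ^ n * (q ^ n) ^ N)"
        by (simp add: q_def fls_vanish_X_power flip: power_mult power_add)
      have "N \<le> n + n * N" using n by (cases n) auto
      then show "int N \<le> int (n + n * N)" by (simp only: of_nat_le_iff)
    qed
    have "fls_vanish 0 (of_nat (Suc N) - of_nat N * q ^ n)"
      using fls_vanish_mult_left[of 0 "q ^ n" "of_nat N"]
      by (intro fls_vanish_diff fls_vanish_of_nat) (simp_all add: q_def fls_vanish_X_power)
    from fls_vanish_mult_right[OF v this]
    show "fls_vanish (int N) (q ^ n / (1 - q ^ n)\<^sup>2 - (\<Sum>m=1..N. of_nat m * (q ^ n) ^ m))"
      unfolding sum_multiples_powers[OF n1] unfolding q_def
      by (rule fls_vanish_divide_one_minus_power) (use n in simp)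
    show "fls_vanish (int N) (of_nat n * q ^ n / (1 - q ^ n) - (\<Sum>m=1..N. of_nat n * (q ^ n) ^ m))"
      using fls_vanish_divide_one_minus_power[OF fls_vanish_mult_left[OF v, of "of_nat n"], of n 1] n
      unfolding sum_powers_multiple[OF n1] by (simp add: q_def mult.assoc)
  qed
  finally show ?thesis .
qed

text \<open>The extra factor is only 1 + O(q^(N-r+1)), which is weak for r close to N. The summand
  itself is O(q^r), however, so the two orders add up to N + 1 for every r.\<close>

lemma bailey_sum_cong:
  "fls_vanish (int N) ((\<Sum>r=1..N. bailey_alpha q d e r * (q ^ r / (1 - q ^ r)\<^sup>2)
        * (qfact q N ^ 2 / (qfact q (N - r) * qfact q (N + r)))) - bailey_sum q d e N)"
  unfolding bailey_sum_def sum_subtractf[symmetric]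
proof (intro fls_vanish_sum)
  fix r assume r: "r \<in> {1..N}"
  define x where "x = qfact q N / qfact q (N - r)"
  define y where "y = qfact q (N + r) / qfact q N"
  have x: "fls_vanish (int (N - r) + 1) (x - 1)"
    using qprod_fls_ratio[of "N - r" N "- 1 :: 'a"] by (simp add: x_def qfact_eq_qprod q_def)
  have "fls_vanish (int N + 1) (y - 1)"
    using qprod_fls_ratio[of N "N + r" "- 1 :: 'a"] by (simp add: y_def qfact_eq_qprod q_def)
  from fls_vanish_one_minus(3,4)[OF this]
  have y: "fls_vanish (int N + 1) (inverse y - 1)" "fls_vanish 0 (inverse y)" by simp_all
  have "qfact q N ^ 2 / (qfact q (N - r) * qfact q (N + r)) = x * inverse y"
    by (simp add: x_def y_def field_simps power2_eq_square)
  moreover have "fls_vanish (int (N - r) + 1) (x * inverse y - 1 * 1)"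
    by (rule fls_vanish_mult_cong[OF x fls_vanish_mono[OF y(1)]]) (use fls_vanish_one_minus(2)[OF x] in simp_all)
  moreover have "fls_vanish (int r) (bailey_alpha q d e r * (q ^ r / (1 - q ^ r)\<^sup>2))"
    using r unfolding q_def[symmetric]
    by (intro fls_vanish_mult_left bailey_alpha_vanish)
       (auto simp: q_def fls_vanish_X_power intro!: fls_vanish_divide_one_minus_power)
  ultimately have "fls_vanish (int r + (int (N - r) + 1)) (bailey_alpha q d e r * (q ^ r / (1 - q ^ r)\<^sup>2)
     * (qfact q N ^ 2 / (qfact q (N - r) * qfact q (N + r)) - 1))"
    by (intro fls_vanish_mult) simp_all
  then have "fls_vanish (int N) (bailey_alpha q d e r * (q ^ r / (1 - q ^ r)\<^sup>2)
     * (qfact q N ^ 2 / (qfact q (N - r) * qfact q (N + r)) - 1))"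
    by (rule fls_vanish_mono) (use r in simp)
  then show "fls_vanish (int N) (bailey_alpha q d e r * (q ^ r / (1 - q ^ r)\<^sup>2)
        * (qfact q N ^ 2 / (qfact q (N - r) * qfact q (N + r))) - bailey_alpha q d e r * (q ^ r / (1 - q ^ r)\<^sup>2))"
    by (simp add: right_diff_distrib)
qed

lemma euler_quotient_vanish: "fls_vanish 0 (euler_quotient q d e N)"
proof -
  have "fls_vanish 0 (qprod q d N * qprod q e N * (inverse (qfact q N) * inverse (qprod q (- (d * e)) N)))"
    using fls_vanish_one_minus(2,4)[OF qprod_fls_unit[of a N]] fls_vanish_one_minus(2,4)[OF qprod_fls_unit[of b N]]
      fls_vanish_one_minus(4)[OF qprod_fls_unit[of "-1" N]] fls_vanish_one_minus(4)[OF qprod_fls_unit[of "- (a * b)" N]]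
    by (intro fls_vanish_mult_left[of 0]) (simp_all add: q_def d_def e_def qfact_eq_qprod)
  then show ?thesis by (simp add: euler_quotient_def field_simps)
qed

lemma gen_fun_spt_cong:
  "fls_vanish (int N) (fps_to_fls (\<Sum>k=1..N. gen_fun (spt_pairs N k) pair_size (spt_weight a b))
     - euler_quotient q d e N * (lambert_sum q N + bailey_sum q d e N))"
proof -
  have hyp: "q ^ n \<noteq> 1" "1 + d * q ^ n \<noteq> 0" "1 + e * q ^ n \<noteq> 0" if "n > 0" for n
    using that by (simp_all add: q_def d_def e_def fls_X_power_neq_1 one_plus_const_X_power_nonzero)
  have T: "(\<Sum>n=1..N. qfact q (n - 1) ^ 2 * q ^ n * (qprod q (- (d * e)) n / (qfact q n * qprod q d n * qprod q e n)))
   = (\<Sum>n=1..N. q ^ n / (1 - q ^ n)\<^sup>2) +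
     (\<Sum>r=1..N. bailey_alpha q d e r * (q ^ r / (1 - q ^ r)\<^sup>2)
        * (qfact q N ^ 2 / (qfact q (N - r) * qfact q (N + r))))"
    by (rule bailey_transform_finite[OF hyp])
  have "fls_vanish (int N) (euler_quotient q d e N *
    (((\<Sum>n=1..N. q ^ n / (1 - q ^ n)\<^sup>2) - lambert_sum q N) +
     ((\<Sum>r=1..N. bailey_alpha q d e r * (q ^ r / (1 - q ^ r)\<^sup>2)
        * (qfact q N ^ 2 / (qfact q (N - r) * qfact q (N + r)))) - bailey_sum q d e N)))"
    by (intro fls_vanish_mult_left euler_quotient_vanish fls_vanish_add lambert_sum_cong bailey_sum_cong)
  moreover have "E * ((A - L) + (B - S)) = E * (A + B) - E * (L + S)" for E A B L S :: "'a fls"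
    by (simp add: algebra_simps)
  ultimately show ?thesis
    unfolding gen_fun_spt_total T by simp
qed

end

section \<open>The bilateral sum\<close>

text \<open>Serves the unordered sum over triples: modulo q^m only n < m survive, and then r and s
  are bounded as well.\<close>

lemma spt_nonzero_imp_le:
  assumes "spt r s n \<noteq> 0"
  shows "r \<le> n" "s \<le> n"
proof -
  have "{(l, m) \<in> overpartition_pairs n. r = num_overlined l + num_nonoverlined m \<and>
      s = num_parts m \<and> spt_admissible (l, m)} \<noteq> {}"
    using assms unfolding spt_def by (metis (no_types, lifting) sum.empty)
  then obtain l m where "(l, m) \<in> overpartition_pairs n" "spt_admissible (l, m)"
    "r = num_overlined l + num_nonoverlined m" "s = num_parts m"
    by auto
  then show "r \<le> n" "s \<le> n"
    using admissible_pair_bounds(2,3)[of "(l, m)" n] by (auto simp: pair_r_def)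
qed

lemma fls_sum_nth: "sum f A $$ i = (\<Sum>x\<in>A. f x $$ i)" for f :: "'b \<Rightarrow> 'a::comm_monoid_add fls"
  by (induction A rule: infinite_finite_induct) auto

lemma tendsto_fls_cong:
  fixes f g :: "nat \<Rightarrow> 'a::ab_group_add fls"
  assumes "g \<longlonglongrightarrow> L" "\<And>n. fls_vanish (int n) (f n - g n)"
  shows "f \<longlonglongrightarrow> L"
proof -
  have "(\<lambda>n. f n - g n) \<longlonglongrightarrow> 0" using assms(2) by (intro tendsto_fls_offsetI) simp
  from tendsto_add[OF this assms(1)] show ?thesis by simp
qed

text \<open>Sums over initial segments stand for m (m + 1) / 2 and m (m - 1) / 2 and eliminate the
  integer division; at index -m the exponent is the second number minus m.\<close>

lemma triangular_powi:
  fixes q :: "'a::field"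
  assumes "q \<noteq> 0"
  shows "q powi ((int m + 1) * int m div 2 + int m) = q ^ (\<Sum>{..m}) * q ^ m"
    "q powi ((- int m + 1) * - int m div 2 + - int m) = q ^ (\<Sum>{..<m}) / q ^ m"
proof -
  have "2 * int (\<Sum>{..m}) = (int m + 1) * int m" "2 * int (\<Sum>{..<m}) = (- int m + 1) * - int m"
    by (induction m) (simp_all add: algebra_simps)
  then have "(int m + 1) * int m div 2 + int m = int (\<Sum>{..m} + m)"
     "(- int m + 1) * - int m div 2 + - int m = int (\<Sum>{..<m}) + - int m" by simp_all
  then show "q powi ((int m + 1) * int m div 2 + int m) = q ^ (\<Sum>{..m}) * q ^ m"
    "q powi ((- int m + 1) * - int m div 2 + - int m) = q ^ (\<Sum>{..<m}) / q ^ m"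
    using assms by (simp_all only: power_int_of_nat power_add power_int_add power_int_minus divide_inverse simp_thms)
qed

context
  fixes a b :: "'a::field" and q d e :: "'a fls"
  defines "q \<equiv> fls_X" and "d \<equiv> fls_const a" and "e \<equiv> fls_const b"
  assumes ab: "a \<noteq> 0" "a \<noteq> - 1" "b \<noteq> 0" "b \<noteq> - 1"
begin

lemma de_nonzero: "d \<noteq> 0" "e \<noteq> 0" "q \<noteq> 0"
  using ab by (simp_all add: d_def e_def q_def)

text \<open>A constant times a power of q equals 1 only if the exponent is 0 and the constant is 1.
  Negative indices do reach the exponent 0, so -d = 1 and -1/d = 1 must be excluded, and likewise
  for e: here \<open>a \<noteq> - 1\<close> and \<open>b \<noteq> - 1\<close> enter.\<close>

lemma qpoch_arguments:
  "x \<in> set [- (1 / d), - (1 / e)] \<Longrightarrow> x * fls_X powi i \<noteq> 1"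
  "x \<in> set [- d * fls_X, - e * fls_X] \<Longrightarrow> x * fls_X powi i \<noteq> 1"
proof -
  have 1: "- (1 / fls_const c) * fls_X powi i \<noteq> 1" if "c \<noteq> - 1" for c :: 'a
  proof -
    have "- (1 / c) \<noteq> 1" using that by (cases "c = 0") (auto simp: field_simps)
    from fls_const_X_powi_neq_1[OF this] show ?thesis
      by (metis fls_const_divide_const fls_const_1 fls_const_uminus)
  qed
  have 2: "- fls_const c * fls_X * fls_X powi i \<noteq> 1" if "c \<noteq> - 1" for c :: 'a
  proof -
    have "- c \<noteq> 1" using that by (metis minus_minus)
    from fls_const_X_powi_neq_1[OF this, of "i + 1"] show ?thesis
      by (simp add: power_int_add mult_ac)
  qed
  show "x \<in> set [- (1 / d), - (1 / e)] \<Longrightarrow> x * fls_X powi i \<noteq> 1"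
    "x \<in> set [- d * fls_X, - e * fls_X] \<Longrightarrow> x * fls_X powi i \<noteq> 1"
    using 1[of a] 1[of b] 2[of a] 2[of b] ab by (auto simp: d_def e_def)
qed

definition N2_term :: "int \<Rightarrow> 'a fls" where
  "N2_term n = ((- 1) powi (n - 1) * fls_X powi ((n + 1) * n div 2 + n) * (d * e) powi n *
           qpoch [- (1 / d), - (1 / e)] n) /
        ((1 - fls_X powi n)\<^sup>2 * qpoch [- d * fls_X, - e * fls_X] n)"

lemma N2_term_of_nat:
  assumes "m > 0"
  shows "N2_term (int m) = - bailey_core q d e m * (q ^ (\<Sum>{..m}) * q ^ m / (1 - q ^ m)\<^sup>2)"
proof -
  have arg: "x * fls_X ^ t \<noteq> 1" if "x \<in> set [- (1 / d), - (1 / e)] \<or> x \<in> set [- d * fls_X, - e * fls_X]" for x t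
    using qpoch_arguments[of x "int t"] that by (auto simp: power_int_of_nat)
  have 1: "(d * e) ^ m * qpoch [- (1 / d), - (1 / e)] (int m) = qshift q d m * qshift q e m"
  proof -
    have "qpoch [- (1 / d), - (1 / e)] (int m) = (\<Prod>t<m. \<Prod>x\<leftarrow>[- (1 / d), - (1 / e)]. 1 - x * fls_X ^ t)"
      by (rule qpoch_of_nat[OF arg]) simp
    also have "\<dots> = (\<Prod>t<m. 1 - - (1 / d) * q ^ t) * (\<Prod>t<m. 1 - - (1 / e) * q ^ t)"
      by (simp add: prod.distrib q_def)
    finally show ?thesis
      unfolding qshift_eq_scaled_prod[OF de_nonzero(1), of m q, symmetric]
        qshift_eq_scaled_prod[OF de_nonzero(2), of m q, symmetric]
      by (simp only: power_mult_distrib mult_ac)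
  qed
  have 2: "qpoch [- d * fls_X, - e * fls_X] (int m) = qprod q d m * qprod q e m"
  proof -
    have "qpoch [- d * fls_X, - e * fls_X] (int m) = (\<Prod>t<m. \<Prod>x\<leftarrow>[- d * fls_X, - e * fls_X]. 1 - x * fls_X ^ t)"
      by (rule qpoch_of_nat[OF arg]) simp
    then show ?thesis by (simp add: prod.distrib q_def qprod_def mult.assoc)
  qed
  have 3: "(- 1 :: 'a fls) powi (int m - 1) = - ((- 1) ^ m)"
    using assms by (simp add: power_int_diff)
  have "N2_term (int m) = - ((- 1) ^ m) * (q ^ (\<Sum>{..m}) * q ^ m) * ((d * e) ^ m * qpoch [- (1 / d), - (1 / e)] (int m)) /
     ((1 - q ^ m)\<^sup>2 * qpoch [- d * fls_X, - e * fls_X] (int m))"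
    unfolding N2_term_def 3 q_def[symmetric] triangular_powi[OF de_nonzero(3)] power_int_of_nat by (simp only: mult.assoc)
  also have "\<dots> = - bailey_core q d e m * (q ^ (\<Sum>{..m}) * q ^ m / (1 - q ^ m)\<^sup>2)"
    unfolding 1 2 by (simp add: bailey_core_def mult_ac)
  finally show ?thesis .
qed

text \<open>Reflection gives (-1/d)_(-m) = q^(m(m+1)/2) d^m / (-dq)_m and 1 / (-dq)_(-m) =
  q^(-m(m-1)/2) d^m (-1/d)_m, and the same for e. Together with (1 - q^(-m))^2 = (1 - q^m)^2 /
  q^(2m), the term becomes q^m times the one at index m.\<close>

lemma N2_term_minus:
  assumes "m > 0"
  shows "N2_term (- int m) = - bailey_core q d e m * (q ^ (\<Sum>{..m}) * q ^ (2 * m) / (1 - q ^ m)\<^sup>2)"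
proof -
  define u v where "u = q ^ (\<Sum>{..<m})" and "v = q ^ m"
  define P where "P x = (\<Prod>t<m. 1 - - (1 / x) * q powi (- int m) * q ^ t)" for x
  define R where "R x = (\<Prod>t<m. 1 - - x * q * q powi (- int m) * q ^ t)" for x
  have "{..m} = insert m {..<m}" by auto
  then have uv: "q ^ (\<Sum>{..m}) = v * u" by (simp add: u_def v_def power_add)
  have nz: "u \<noteq> 0" "v \<noteq> 0" "1 - v \<noteq> 0"
    using de_nonzero fls_X_power_neq_1[OF assms] by (auto simp: u_def v_def q_def)
  have qp: "qprod q x m = v * u * (x ^ m * P x)" if "x \<noteq> 0" for x
    using qprod_eq_scaled_powi_prod[OF that de_nonzero(3), of m] by (simp add: P_def uv)
  have qs: "qshift q x m = u * R x" for x
    using qshift_eq_powi_prod[OF de_nonzero(3), of m x] by (simp add: R_def u_def)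
  have P: "P d \<noteq> 0" "P e \<noteq> 0"
    using qprod_nz(1)[of a m] qprod_nz(2)[of b m] qp[OF de_nonzero(1)] qp[OF de_nonzero(2)] by (auto simp: q_def d_def e_def)
  have 1: "qpoch [- (1 / d), - (1 / e)] (- int m) = 1 / (P d * P e)"
    by (subst qpoch_minus_of_nat, erule qpoch_arguments(1)) (simp add: prod.distrib q_def P_def)
  have 2: "qpoch [- d * fls_X, - e * fls_X] (- int m) = 1 / (R d * R e)"
    by (subst qpoch_minus_of_nat, erule qpoch_arguments(2)) (simp add: prod.distrib q_def R_def)
  have 3: "(- 1 :: 'a fls) powi (- int m - 1) = - ((- 1) ^ m)"
    by (cases "even m") (simp_all add: power_int_diff power_int_minus)
  have 4: "(1 - q powi (- int m))\<^sup>2 = (1 - v)\<^sup>2 / v\<^sup>2"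
    using nz by (simp add: power_int_minus v_def[symmetric] field_simps power2_eq_square)
  have 5: "(d * e) powi (- int m) = 1 / (d ^ m * e ^ m)"
    by (simp add: power_int_minus power_mult_distrib field_simps)
  have "N2_term (- int m) = - ((- 1) ^ m) * (u / v) * (1 / (d ^ m * e ^ m)) * (1 / (P d * P e)) /
     ((1 - v)\<^sup>2 / v\<^sup>2 * (1 / (R d * R e)))"
    unfolding N2_term_def 1 2 3 unfolding q_def[symmetric] triangular_powi[OF de_nonzero(3)] 4 5
    unfolding u_def[symmetric] v_def[symmetric] ..
  also have "\<dots> = - bailey_core q d e m * (q ^ (\<Sum>{..m}) * q ^ (2 * m) / (1 - q ^ m)\<^sup>2)"
  proof -
    have gen: "- s * (u / v) * (1 / (D * E)) * (1 / (p * p')) / (w / v\<^sup>2 * (1 / (r * r'))) =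
        - (s * (u * r * (u * r')) / (v * u * (D * p) * (v * u * (E * p')))) * (v * u * v\<^sup>2 / w)"
      if "D \<noteq> 0" "E \<noteq> 0" "p \<noteq> 0" "p' \<noteq> 0" "w \<noteq> 0" for s D E p p' r r' w :: "'a fls"
      using that nz by (simp add: field_simps power2_eq_square)
    show ?thesis
      unfolding bailey_core_def uv qp[OF de_nonzero(1)] qp[OF de_nonzero(2)] qs power_mult v_def[symmetric] mult.commute[of 2 m]
      by (rule gen) (use P nz de_nonzero in simp_all)
  qed
  finally show ?thesis .
qed

text \<open>The terms m and q^m times it add up to the factor 1 + q^m of alpha_m. The minus sign
  stems from (-1)^(n-1) and later cancels against the subtraction of \<open>N2\<close> in
  \<open>Spt\<close>.\<close>

lemma sum_N2_term: "(\<Sum>n\<in>{- int N..int N} - {0}. N2_term n) = - bailey_sum q d e N"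
proof (induction N)
  case (Suc N)
  have "{- int (Suc N)..int (Suc N)} - {0} = insert (int (Suc N)) (insert (- int (Suc N)) ({- int N..int N} - {0}))"
    by auto
  then have "(\<Sum>n\<in>{- int (Suc N)..int (Suc N)} - {0}. N2_term n) =
     N2_term (int (Suc N)) + (N2_term (- int (Suc N)) + - bailey_sum q d e N)"
    using Suc.IH by simp
  also have "\<dots> = - bailey_sum q d e (Suc N)"
  proof -
    have "bailey_alpha q d e (Suc N) = bailey_core q d e (Suc N) * (q ^ (\<Sum>{..Suc N}) * (1 + q ^ Suc N))"
      by (simp add: bailey_alpha_def bailey_core_def mult_ac)
    moreover have "q ^ (2 * Suc N) = q ^ Suc N * q ^ Suc N" unfolding mult_2 power_add ..
    moreover have "- c * (t * v / z) + (- c * (t * (v * v) / z) + - w) = - (w + c * (t * (1 + v)) * (v / z))"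
      for c t v w z :: "'a fls"
      by (simp add: algebra_simps add_divide_distrib)
    ultimately show ?thesis
      unfolding N2_term_of_nat[OF zero_less_Suc] N2_term_minus[OF zero_less_Suc]
      by (simp only: bailey_sum_def sum.cl_ivl_Suc) simp
  qed
  finally show ?case .
qed (simp add: bailey_sum_def)

text \<open>The order comes from the factor q^m or q^(2m). Its growth in both directions makes the
  bilateral series converge as an unordered sum.\<close>

lemma N2_term_vanish:
  assumes "n \<noteq> 0"
  shows "fls_vanish \<bar>n\<bar> (N2_term n)"
proof -
  define m where "m = nat \<bar>n\<bar>"
  have m: "m > 0" "\<bar>n\<bar> = int m" using assms by (auto simp: m_def)
  have v: "fls_vanish (int m) (- bailey_core q d e m * (q ^ k * q ^ l / (1 - q ^ m)\<^sup>2))" if "m \<le> l" for k l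
    using that m unfolding q_def d_def e_def
    by (intro fls_vanish_mult_left fls_vanish_divide_one_minus_power)
       (auto simp: fls_vanish_X_power fls_vanish_minus_iff bailey_core_vanish)
  consider "n = int m" | "n = - int m" using m(2) by linarith
  then show ?thesis
  proof cases
    case 1
    show ?thesis unfolding m(2) unfolding 1 N2_term_of_nat[OF m(1)] by (rule v) simp
  next
    case 2
    show ?thesis unfolding m(2) unfolding 2 N2_term_minus[OF m(1)] by (rule v) simp
  qed
qed

lemma euler_quotient_limit:
  "euler_quotient q d e \<longlonglongrightarrow> qpoch_inf [- d * fls_X, - e * fls_X] / qpoch_inf [fls_X, d * e * fls_X]"
proof -
  \<comment> \<open>All arguments of the prefactor carry one power of q, so 1 - c q^(t+1) has
    constant coefficient 1 and is nonzero for every constant c.\<close>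
  have arg: "c * fls_X * fls_X ^ t \<noteq> 1" if "c = fls_const x" for c :: "'a fls" and x t
    using one_plus_const_X_power_nonzero[of "Suc t" "- x"] that
    by (simp add: mult.assoc)
  have "(\<lambda>N. \<Prod>t<N. \<Prod>x\<leftarrow>[- d * fls_X, - e * fls_X]. 1 - x * fls_X ^ t) \<longlonglongrightarrow> qpoch_inf [- d * fls_X, - e * fls_X]"
    by (rule qpoch_inf_limit) (use arg[of "- d" "- a"] arg[of "- e" "- b"] in \<open>auto simp: d_def e_def\<close>)
  moreover have "(\<lambda>N. \<Prod>t<N. \<Prod>x\<leftarrow>[fls_X, d * e * fls_X]. 1 - x * fls_X ^ t) \<longlonglongrightarrow> qpoch_inf [fls_X, d * e * fls_X]"
    "qpoch_inf [fls_X, d * e * fls_X] \<noteq> 0"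
    by (rule qpoch_inf_limit; use arg[of 1 1] arg[of "d * e" "a * b"] in \<open>auto simp: d_def e_def\<close>)+
  ultimately have "(\<lambda>N. (\<Prod>t<N. \<Prod>x\<leftarrow>[- d * fls_X, - e * fls_X]. 1 - x * fls_X ^ t) /
     (\<Prod>t<N. \<Prod>x\<leftarrow>[fls_X, d * e * fls_X]. 1 - x * fls_X ^ t))
      \<longlonglongrightarrow> qpoch_inf [- d * fls_X, - e * fls_X] / qpoch_inf [fls_X, d * e * fls_X]"
    by (intro tendsto_divide_fls)
  then show ?thesis
    by (simp add: euler_quotient_def[abs_def] qprod_def qfact_def q_def prod.distrib mult_ac)
qed

text \<open>The limits L and S are only shown to exist. The two sums in \<open>Spt\<close> are then
  L and -S, because their partial sums over 1..N and over symmetric intervals are the truncated sums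
  up to sign.\<close>

lemma Spt_limit:
  "(\<lambda>N. euler_quotient q d e N * (lambert_sum q N + bailey_sum q d e N)) \<longlonglongrightarrow> Spt d e"
proof -
  let ?E = "qpoch_inf [- d * fls_X, - e * fls_X] / qpoch_inf [fls_X, d * e * fls_X]"
  have lt: "fls_vanish (int n) (of_nat n * q ^ n / (1 - q ^ n))" if "n > 0" for n
    using fls_vanish_divide_one_minus_power[OF fls_vanish_mult_left[of "int n" "q ^ n" "of_nat n"], of n 1] that
    by (simp add: q_def fls_vanish_X_power)
  have "fls_vanish (int N) (lambert_sum q (Suc N) - lambert_sum q N)" for N
    using fls_vanish_mono[OF lt[of "Suc N"], of "int N"] by (simp add: lambert_sum_def)
  then obtain L where L: "lambert_sum q \<longlonglongrightarrow> L"
    using fls_sequence_convergentI by blast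
  have bt: "fls_vanish (int r) (bailey_alpha q d e r * (q ^ r / (1 - q ^ r)\<^sup>2))" if "r > 0" for r
    using that unfolding q_def d_def e_def
    by (intro fls_vanish_mult_left bailey_alpha_vanish fls_vanish_divide_one_minus_power) (auto simp: fls_vanish_X_power)
  have "fls_vanish (int N) (bailey_sum q d e (Suc N) - bailey_sum q d e N)" for N
    using fls_vanish_mono[OF bt[of "Suc N"], of "int N"] by (simp add: bailey_sum_def)
  then obtain S where S: "bailey_sum q d e \<longlonglongrightarrow> S"
    using fls_sequence_convergentI by blast
  have "((\<lambda>n. of_nat n * fls_X ^ n / (1 - fls_X ^ n)) has_sum L) {n::nat. n \<ge> 1}"
  proof (rule has_sum_flsI[where B = "\<lambda>N. {1..N}"])
    show "(\<lambda>N. \<Sum>n=1..N. of_nat n * fls_X ^ n / (1 - fls_X ^ n)) \<longlonglongrightarrow> L"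
      using L by (simp add: lambert_sum_def[abs_def] q_def)
    show "finite {n \<in> {n::nat. n \<ge> 1}. \<not> fls_vanish m (of_nat n * fls_X ^ n / (1 - fls_X ^ n) :: 'a fls)}" for m
    proof (rule finite_subset[of _ "{..nat m}"])
      show "{n \<in> {n::nat. n \<ge> 1}. \<not> fls_vanish m (of_nat n * fls_X ^ n / (1 - fls_X ^ n) :: 'a fls)} \<subseteq> {..nat m}"
      proof
        fix n assume n: "n \<in> {n \<in> {n::nat. n \<ge> 1}. \<not> fls_vanish m (of_nat n * fls_X ^ n / (1 - fls_X ^ n) :: 'a fls)}"
        then have "\<not> m \<le> int n" using fls_vanish_mono[OF lt[of n], of m] by (auto simp: q_def)
        then show "n \<in> {..nat m}" by auto
      qed
    qed simp
  qed (auto intro: eventually_ge_at_top)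
  moreover have "(N2_term has_sum - S) {n::int. n \<noteq> 0}"
  proof (rule has_sum_flsI[where B = "\<lambda>N. {- int N..int N} - {0}"])
    show "(\<lambda>N. \<Sum>n\<in>{- int N..int N} - {0}. N2_term n) \<longlonglongrightarrow> - S"
      using tendsto_mult[OF tendsto_const[of "- 1"] S] by (simp add: sum_N2_term)
    show "eventually (\<lambda>N. n \<in> {- int N..int N} - {0}) sequentially" if "n \<in> {n::int. n \<noteq> 0}" for n
      using eventually_ge_at_top[of "nat \<bar>n\<bar>"] by eventually_elim (use that in auto)
    show "finite {n \<in> {n::int. n \<noteq> 0}. \<not> fls_vanish m (N2_term n)}" for m
    proof (rule finite_subset[of _ "{- \<bar>m\<bar>..\<bar>m\<bar>}"])
      show "{n \<in> {n::int. n \<noteq> 0}. \<not> fls_vanish m (N2_term n)} \<subseteq> {- \<bar>m\<bar>..\<bar>m\<bar>}"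
      proof
        fix n assume n: "n \<in> {n \<in> {n::int. n \<noteq> 0}. \<not> fls_vanish m (N2_term n)}"
        then have "\<not> m \<le> \<bar>n\<bar>" using fls_vanish_mono[OF N2_term_vanish[of n], of m] by auto
        then show "n \<in> {- \<bar>m\<bar>..\<bar>m\<bar>}" by auto
      qed
    qed simp
  qed auto
  ultimately have "Spt d e = ?E * L - ?E * - S"
    unfolding Spt_def N2_def N2_term_def[symmetric] by (simp add: infsumI)
  then have "Spt d e = ?E * (L + S)" by (simp only: distrib_left mult_minus_right diff_minus_eq_add)
  then show ?thesis
    using tendsto_mult[OF euler_quotient_limit tendsto_add[OF L S]] by simp
qed

text \<open>Cubes of side N exhaust the triples, and below degree N the sum over a cube has the
  coefficients of the truncated generating function, since only n = i contributes to coefficient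
  i.\<close>

lemma spt_has_sum:
  "((\<lambda>(r, s, n). of_nat (spt r s n) * d ^ r * e ^ s * fls_X ^ n) has_sum Spt d e) (UNIV :: (nat \<times> nat \<times> nat) set)"
proof (rule has_sum_flsI[where B = "\<lambda>N. {..N} \<times> {..N} \<times> {..N}"])
  let ?G = "\<lambda>N. fps_to_fls (\<Sum>k=1..N. gen_fun (spt_pairs N k) pair_size (spt_weight a b))"
  let ?f = "\<lambda>(r, s, n). of_nat (spt r s n) * d ^ r * e ^ s * fls_X ^ n"
  have f: "of_nat (spt r s n) * d ^ r * e ^ s * fls_X ^ n = fls_const (of_nat (spt r s n) * a ^ r * b ^ s) * fls_X ^ n" for r s n
    by (simp add: d_def e_def fls_const_power fls_of_nat flip: fls_const_mult_const)
  have "fls_vanish (int N) (sum ?f ({..N} \<times> {..N} \<times> {..N}) - ?G N)" for N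
  proof (rule fls_vanishI)
    fix i assume i: "i < int N"
    have "sum ?f ({..N} \<times> {..N} \<times> {..N}) $$ i =
       (\<Sum>r\<le>N. \<Sum>s\<le>N. \<Sum>n\<le>N. (fls_const (of_nat (spt r s n) * a ^ r * b ^ s) * fls_X ^ n) $$ i)"
      unfolding fls_sum_nth by (simp add: sum.cartesian_product' f)
    also have "\<dots> = ?G N $$ i"
    proof (cases "i < 0")
      case False
      define n where "n = nat i"
      have n: "i = int n" "n \<le> N" using i False by (auto simp: n_def)
      have "(\<Sum>r\<le>N. \<Sum>s\<le>N. \<Sum>n\<le>N. (fls_const (of_nat (spt r s n) * a ^ r * b ^ s) * fls_X ^ n) $$ i)
         = (\<Sum>r\<le>N. \<Sum>s\<le>N. \<Sum>n'\<le>N. if n' = n then of_nat (spt r s n') * a ^ r * b ^ s else 0)"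
        unfolding n(1) by (intro sum.cong refl) auto
      also have "\<dots> = (\<Sum>r\<le>N. \<Sum>s\<le>N. of_nat (spt r s n) * a ^ r * b ^ s)"
        using n(2) by simp
      finally show ?thesis using sum_spt_eq_gen_fun_nth[OF n(2), of a b] n(1) by simp
    qed simp
    finally show "(sum ?f ({..N} \<times> {..N} \<times> {..N}) - ?G N) $$ i = 0" by simp
  qed
  moreover have "?G \<longlonglongrightarrow> Spt d e"
    using Spt_limit gen_fun_spt_cong[of _ a b] unfolding q_def d_def e_def by (rule tendsto_fls_cong)
  ultimately show "(\<lambda>N. sum ?f ({..N} \<times> {..N} \<times> {..N})) \<longlonglongrightarrow> Spt d e"
    by (rule tendsto_fls_cong[rotated])
  show "eventually (\<lambda>N. x \<in> {..N} \<times> {..N} \<times> {..N}) sequentially" for x :: "nat \<times> nat \<times> nat"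
    using eventually_ge_at_top[of "Max {fst x, fst (snd x), snd (snd x)}"]
    by eventually_elim (cases x, auto)
  show "finite {x \<in> UNIV. \<not> fls_vanish m (?f x)}" for m
  proof (rule finite_subset[of _ "{..nat m} \<times> {..nat m} \<times> {..nat m}"])
    show "{x \<in> UNIV. \<not> fls_vanish m (?f x)} \<subseteq> {..nat m} \<times> {..nat m} \<times> {..nat m}"
    proof
      fix x assume "x \<in> {x \<in> UNIV. \<not> fls_vanish m (?f x)}"
      moreover obtain r s n where x: "x = (r, s, n)" by (cases x)
      ultimately have nv: "\<not> fls_vanish m (fls_const (of_nat (spt r s n) * a ^ r * b ^ s) * fls_X ^ n)"
        by (simp add: f)
      then have "int n < m" using fls_vanish_mono[OF fls_vanish_const_X_power] by (metis not_le)
      moreover have "spt r s n \<noteq> 0" using nv by (intro notI) simp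
      ultimately show "x \<in> {..nat m} \<times> {..nat m} \<times> {..nat m}"
        using spt_nonzero_imp_le[of r s n] x by auto
    qed
  qed simp
qed auto

end

theorem theorem7p1:
  shows "((\<lambda>(r, s, n). of_nat (spt r s n) * d_var ^ r * e_var ^ s * fls_X ^ n)
            has_sum Spt d_var e_var) (UNIV :: (nat \<times> nat \<times> nat) set)"
  \<comment> \<open>It remains to see that the indeterminates differ from 0 and -1 in the fraction
    field, which is decided by comparing polynomials in Z[d][e].\<close>
  unfolding d_var_def e_var_def
  by (rule spt_has_sum) (simp_all add: Zero_fract_def One_fract_def eq_fract one_pCons)

end
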